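(* Let $A=(A^R\mid A^I)$ be as in the context. The pair $(\mathcal{T}^*,\mathcal{C}(A^R))$ is a finite universal double test set for the standard mixed integer program. That is, $\mathcal{T}^*$ and $\mathcal{C}(A^R)$ are finite sets, and for every $\mathbf b\in\mathbb{Z}^m$, every $\mathbf c\in\mathbb{Z}^n$ and every feasible non-optimal solution $\mathbf x$ of $\min\{\mathbf c^T\mathbf x: A\mathbf x=\mathbf b,\ \mathbf x\ge\mathbf 0,\ \mathbf x\in\mathbb{R}^{n_R}\times\mathbb{Z}^{n_I}\}$ there exist $\mathbf t_0\in\mathcal{T}^*\cup\{\mathbf 0\}$, padded circuits $\mathbf s_1,\dots,\mathbf s_\ell\in\mathcal{C}(A^R)$ and real numbers $\beta_1,\dots,\beta_\ell\ge 0$ such that $\bar{\mathbf x}=\mathbf x+\mathbf t_0+\sum_{i=1}^{\ell}\beta_i\mathbf s_i$ is feasible and $\mathbf c^T\bar{\mathbf x}<\mathbf c^T\mathbf x$.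
   Context: Setting: $A=(A^R\mid A^I)\in\mathbb{Z}^{m\times n}$ with $A^R\in\mathbb{Z}^{m\times n_R}$, $A^I\in\mathbb{Z}^{m\times n_I}$, $n=n_R+n_I$, $\operatorname{rank}A^R=m$, $n_R>m$. Write $[m]=\{1,\dots,m\}$. Circuits: $\mathcal{C}(A^R)$ is the set of support-minimal nonzero solutions of $A^R\mathbf x=\mathbf 0$, normalized to have integer components with no common divisor (both signs included). They are regarded as vectors of $\mathbb{R}^{n_R}\times\mathbb{Z}^{n_I}$ by appending $n_I$ zeros (padded circuits). Bases: let $B_1,\dots,B_r$ be all bases of $A^R$, i.e. invertible $m\times m$ submatrices formed by $m$ columns of $A^R$. For a basis $B$ and $S\subseteq[m]$ let $$C_B^S=\{\mathbf z : (B^{-1}A^I)_p\mathbf z\ge 0 \text{ for } p\in S,\ (B^{-1}A^I)_p\mathbf z\le 0\text{ for }p\in[m]\setminus S\},$$ where $(B^{-1}A^I)_p$ is the $p$-th row. For a list $S=(S_1,\dots,S_r)$ with $S_i\subseteq[m]$ let $C^S=\{\mathbf z\in\mathbb{Z}^{n_I}:\mathbf z\in C_{B_i}^{S_i}\text{ for all }i=1,\dots,r\}$. Conic Graver basis: for a rational cone (or its set of integer points) $C$ in dimension $n_I$, $\mathcal{G}(C)=\bigcup_{k=1}^{2^{n_I}}H^k(C)$, where $H^k(C)$ is the Hilbert basis of $C\cap\mathbb{O}^k$ and $\mathbb{O}^k$ is the $k$-th orthant of $\mathbb{R}^{n_I}$. The Hilbert basis of a pointed cone is the minimal set of integer vectors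 of the cone generating all its integer points by non-negative integer combinations. $\mathcal{G}^*$ is the union of $\mathcal{G}(C^S)$ over all lists $S=(S_1,\dots,S_r)$ with $S_i\subseteq[m]$. Basic-integer direction of basis $B$ and integer part $\mathbf g\in\mathbb{Z}^{n_I}$: the vector of $\mathbb{R}^{n_R}\times\mathbb{Z}^{n_I}$ whose coordinates indexed by the columns of $B$ are $-B^{-1}A^I\mathbf g$, whose other real coordinates are $0$, and whose integer part is $\mathbf g$. For $G\subseteq\mathbb{Z}^{n_I}$, $\mathcal{T}_B(G)$ is the set of all basic-integer directions of basis $B$ and integer part $\mathbf g\in G$. Finally $\mathcal{T}^*=\bigcup_{i=1}^r\mathcal{T}_{B_i}(\mathcal{G}^* )$. *)

theory Defs
  imports
    "Jordan_Normal_Form.Matrix"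
    "Jordan_Normal_Form.DL_Submatrix"
    "Jordan_Normal_Form.DL_Rank"
    "Jordan_Normal_Form.Gauss_Jordan_Elimination"
begin

abbreviation rvec :: "int vec \<Rightarrow> real vec" where
  "rvec \<equiv> map_vec real_of_int"

abbreviation rmat :: "int mat \<Rightarrow> real mat" where
  "rmat \<equiv> map_mat real_of_int"

text \<open>The matrix \<open>(A | B)\<close>, written like \<^const>\<open>append_rows\<close>.\<close>

definition append_cols :: "'a :: zero mat \<Rightarrow> 'a mat \<Rightarrow> 'a mat" where
  "append_cols A B = four_block_mat A B (0\<^sub>m 0 (dim_col A)) (0\<^sub>m 0 (dim_col B))"


subsection \<open>Mixed integer programs and double test sets\<close>

text \<open>Elements of \<open>\<real>\<^sup>p \<times> \<int>\<^sup>q\<close> are real vectors of dimension \<open>p + q\<close> whose last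
  \<open>q\<close> entries are integers.\<close>

definition mixed_vecs :: "nat \<Rightarrow> nat \<Rightarrow> real vec set" where
  "mixed_vecs nR nI = {x \<in> carrier_vec (nR + nI). \<forall>i\<in>{nR..<nR + nI}. x $ i \<in> \<int>}"

definition mip_feasible :: "nat \<Rightarrow> nat \<Rightarrow> int mat \<Rightarrow> int vec \<Rightarrow> real vec set" where
  "mip_feasible nR nI A b =
     {x \<in> mixed_vecs nR nI. rmat A *\<^sub>v x = rvec b \<and> 0\<^sub>v (nR + nI) \<le> x}"

definition mip_optimal ::
    "nat \<Rightarrow> nat \<Rightarrow> int mat \<Rightarrow> int vec \<Rightarrow> int vec \<Rightarrow> real vec \<Rightarrow> bool" where
  "mip_optimal nR nI A b c x \<longleftrightarrow>
     x \<in> mip_feasible nR nI A b \<and>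
     (\<forall>y \<in> mip_feasible nR nI A b. rvec c \<bullet> x \<le> rvec c \<bullet> y)"

definition universal_double_test_set ::
    "nat \<Rightarrow> nat \<Rightarrow> int mat \<Rightarrow> real vec set \<Rightarrow> real vec set \<Rightarrow> bool" where
  "universal_double_test_set nR nI A T C \<longleftrightarrow>
     (\<forall>b \<in> carrier_vec (dim_row A). \<forall>c \<in> carrier_vec (nR + nI).
        \<forall>x \<in> mip_feasible nR nI A b. \<not> mip_optimal nR nI A b c x \<longrightarrow>
          (\<exists>t\<^sub>0 \<in> T \<union> {0\<^sub>v (nR + nI)}. \<exists>(l::nat) (s :: nat \<Rightarrow> real vec) (\<beta> :: nat \<Rightarrow> real).
             (\<forall>i<l. s i \<in> C \<and> 0 \<le> \<beta> i) \<and>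
             (let x' = x + t\<^sub>0 + finsum_vec TYPE(real) (nR + nI) (\<lambda>i. \<beta> i \<cdot>\<^sub>v s i) {..<l}
              in x' \<in> mip_feasible nR nI A b \<and> rvec c \<bullet> x' < rvec c \<bullet> x)))"


subsection \<open>Circuits\<close>

definition vec_supp :: "'a :: zero vec \<Rightarrow> nat set" where
  "vec_supp v = {i. i < dim_vec v \<and> v $ i \<noteq> 0}"

definition circuits :: "int mat \<Rightarrow> int vec set" where
  "circuits M = {v \<in> carrier_vec (dim_col M).
     v \<noteq> 0\<^sub>v (dim_col M) \<and> M *\<^sub>v v = 0\<^sub>v (dim_row M) \<and>
     (\<forall>w \<in> carrier_vec (dim_col M).
        w \<noteq> 0\<^sub>v (dim_col M) \<and> rmat M *\<^sub>v w = 0\<^sub>v (dim_row M)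
          \<longrightarrow> \<not> vec_supp w \<subset> vec_supp v) \<and>
     Gcd (set\<^sub>v v) = 1}"

definition padded_circuits :: "int mat \<Rightarrow> nat \<Rightarrow> real vec set" where
  "padded_circuits M k = (\<lambda>v. rvec v @\<^sub>v 0\<^sub>v k) ` circuits M"


subsection \<open>Bases and the cones they induce\<close>

text \<open>A basis is given by the set \<open>J\<close> of indices of its columns, taken in increasing order.\<close>

definition basis_mat :: "int mat \<Rightarrow> nat set \<Rightarrow> real mat" where
  "basis_mat AR J = submatrix (rmat AR) UNIV J"

definition bases :: "int mat \<Rightarrow> nat set set" where
  "bases AR = {J. J \<subseteq> {..<dim_col AR} \<and> card J = dim_row AR \<and> invertible_mat (basis_mat AR J)}"

definition basis_tableau :: "int mat \<Rightarrow> int mat \<Rightarrow> nat set \<Rightarrow> real mat" where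
  "basis_tableau AR AI J = the (mat_inverse (basis_mat AR J)) * rmat AI"

definition basis_cone :: "int mat \<Rightarrow> int mat \<Rightarrow> nat set \<Rightarrow> nat set \<Rightarrow> real vec set" where
  "basis_cone AR AI J S = {z \<in> carrier_vec (dim_col AI).
     (\<forall>p \<in> S. row (basis_tableau AR AI J) p \<bullet> z \<ge> 0) \<and>
     (\<forall>p \<in> {..<dim_row AR} - S. row (basis_tableau AR AI J) p \<bullet> z \<le> 0)}"

text \<open>A list \<open>(S\<^sub>1, \<dots>, S\<^sub>r)\<close> with one entry per basis is a function on the set of bases.\<close>

definition int_cone :: "int mat \<Rightarrow> int mat \<Rightarrow> (nat set \<Rightarrow> nat set) \<Rightarrow> int vec set" where
  "int_cone AR AI S = {z \<in> carrier_vec (dim_col AI).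
     \<forall>J \<in> bases AR. rvec z \<in> basis_cone AR AI J (S J)}"


subsection \<open>Hilbert bases and conic Graver bases\<close>

definition nonneg_int_combs :: "nat \<Rightarrow> int vec set \<Rightarrow> int vec set" where
  "nonneg_int_combs d H =
     {finsum_vec TYPE(int) d (\<lambda>h. int (a h) \<cdot>\<^sub>v h) F | a F. finite F \<and> F \<subseteq> H}"

text \<open>The argument \<open>M\<close> is the set of integer points of a cone. Minimality is with respect to
  inclusion; if the cone is pointed, as all cones contained in an orthant are, the minimal
  generating set is unique. Finiteness of \<open>H\<close> is not part of the definition.\<close>

definition is_hilbert_basis :: "nat \<Rightarrow> int vec set \<Rightarrow> int vec set \<Rightarrow> bool" where
  "is_hilbert_basis d M H \<longleftrightarrow>
     H \<subseteq> M \<and> M \<subseteq> nonneg_int_combs d H \<and>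
     (\<forall>H'. H' \<subset> H \<longrightarrow> \<not> M \<subseteq> nonneg_int_combs d H')"

definition hilbert_basis :: "nat \<Rightarrow> int vec set \<Rightarrow> int vec set" where
  "hilbert_basis d M = (THE H. is_hilbert_basis d M H)"

text \<open>The \<open>2\<^sup>d\<close> orthants, indexed by the set \<open>K\<close> of coordinates required to be nonnegative
  (integer points only).\<close>

definition orthant :: "nat \<Rightarrow> nat set \<Rightarrow> int vec set" where
  "orthant d K = {z \<in> carrier_vec d.
     (\<forall>i \<in> K. z $ i \<ge> 0) \<and> (\<forall>i \<in> {..<d} - K. z $ i \<le> 0)}"

definition conic_graver :: "nat \<Rightarrow> int vec set \<Rightarrow> int vec set" where
  "conic_graver d M = (\<Union>K \<in> Pow {..<d}. hilbert_basis d (M \<inter> orthant d K))"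

definition graver_star :: "int mat \<Rightarrow> int mat \<Rightarrow> int vec set" where
  "graver_star AR AI =
     (\<Union>S \<in> {S. \<forall>J \<in> bases AR. S J \<subseteq> {..<dim_row AR}}.
        conic_graver (dim_col AI) (int_cone AR AI S))"


subsection \<open>Basic-integer directions\<close>

text \<open>Column \<open>j \<in> J\<close> of \<open>AR\<close> is column number \<open>card {i \<in> J. i < j}\<close> of \<^term>\<open>basis_mat AR J\<close>.\<close>

definition basic_direction :: "int mat \<Rightarrow> int mat \<Rightarrow> nat set \<Rightarrow> int vec \<Rightarrow> real vec" where
  "basic_direction AR AI J g =
     vec (dim_col AR) (\<lambda>j. if j \<in> J
       then (- (basis_tableau AR AI J *\<^sub>v rvec g)) $ card {i \<in> J. i < j} else 0)
     @\<^sub>v rvec g"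

definition basic_directions ::
    "int mat \<Rightarrow> int mat \<Rightarrow> nat set \<Rightarrow> int vec set \<Rightarrow> real vec set" where
  "basic_directions AR AI J G = basic_direction AR AI J ` G"

definition T_star :: "int mat \<Rightarrow> int mat \<Rightarrow> real vec set" where
  "T_star AR AI = (\<Union>J \<in> bases AR. basic_directions AR AI J (graver_star AR AI))"

end

theory Submission
  imports Defs
begin

text \<open>
  Let \<open>x\<close> be feasible and \<open>y\<close> feasible with smaller cost, and write \<open>y - x = (u, z)\<close> with real part
  \<open>u\<close> and integer part \<open>z\<close>. The integer part lies in some \<open>C\<^sup>S\<close> and some orthant, and so
  \<open>z = \<Sum> a\<^sub>h h\<close> with positive integers \<open>a\<^sub>h\<close> and elements \<open>h\<close> of the Hilbert basis of their
  intersection (\<open>graver_decomposition\<close>). The heart of the proof is to split the real part along with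
  it: \<open>u = \<Sum> a\<^sub>h U\<^sub>h + r\<close> where \<open>(U\<^sub>h, h)\<close> and \<open>(r, 0)\<close> are kernel vectors of \<open>A\<close> and all
  \<open>U\<^sub>h\<close> and \<open>r\<close> have the signs of \<open>u\<close> (\<open>real_part_splits_along_summands\<close>).

  If the support of \<open>u\<close> lies in a basis \<open>B\<close>, then \<open>u\<close> is given by \<open>- B\<^sup>-\<^sup>1 A\<^sup>I z\<close>, which is linear
  in \<open>z\<close>. The cone was chosen so that each row of \<open>B\<^sup>-\<^sup>1 A\<^sup>I\<close> has constant sign on it; hence the
  vectors \<open>- B\<^sup>-\<^sup>1 A\<^sup>I h\<close> have no sign conflicts and serve as \<open>U\<^sub>h\<close>, with \<open>r = 0\<close>. A general \<open>u\<close> is a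
  convex combination of such basic solutions plus a kernel vector of \<open>A\<^sup>R\<close>, all in the closed orthant
  of \<open>u\<close> (\<open>conformal_decomposition_induct\<close>). Different basic solutions may need different
  bases, and this is why the cones \<open>C\<^sup>S\<close> fix the signs for all bases at once.

  Since the summands of \<open>y - x\<close> agree in sign, \<open>x\<close> plus any one of them is nonnegative, and so it is
  feasible; since their costs add up to a negative number, one of them decreases the cost
  (\<open>improving_kernel_step_exists\<close>). That summand has integer part \<open>h\<close> in \<open>\<G>\<^sup>* \<union> {0}\<close>. Its
  real part need not be basic, but it differs from the basic-integer direction of any
  basis only by an element of the kernel of \<open>A\<^sup>R\<close>, and every element of this kernel is a nonnegative
  combination of circuits (\<open>kernel_eq_circuit_combination\<close>).

  Finiteness: circuits with the same support agree up to sign (\<open>circuits_same_support\<close>); there are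
  finitely many cones \<open>C\<^sup>S\<close>, and each has a finite Hilbert basis in each orthant because it
  is rational (\<open>rational_int_cone\<close>, \<open>finite_irreducibles_cone_points\<close>).
\<close>

section \<open>Hilbert bases of integer points of rational cones\<close>

text \<open>A monotone subsequence always exists; if it decreases, it is eventually constant in \<open>\<nat>\<close>, so
  a tail of it increases weakly. This is the one-dimensional case of Dickson's lemma.\<close>

lemma nat_seq_mono_subseq:
  fixes s :: "nat \<Rightarrow> nat"
  shows "\<exists>r :: nat \<Rightarrow> nat. strict_mono r \<and> mono (s \<circ> r)"
proof -
  obtain g :: "nat \<Rightarrow> nat" where g: "strict_mono g" and mg: "monoseq (\<lambda>n. s (g n))"
    using seq_monosub by blast
  show ?thesis
  proof (cases "incseq (\<lambda>n. s (g n))")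
    case True
    then show ?thesis
      using g by (auto simp: comp_def incseq_def mono_def intro!: exI[of _ g])
  next
    case False
    then have dec: "decseq (\<lambda>n. s (g n))"
      using mg by (auto simp: monoseq_iff)
    \<comment> \<open>a decreasing sequence stays constant once it has attained its least value\<close>
    define N where "N = (ARG_MIN (\<lambda>n. s (g n)) n. True)"
    have least: "s (g N) \<le> s (g n)" for n
      unfolding N_def by (rule arg_min_nat_le) simp
    have const: "s (g (N + n)) = s (g N)" for n
      using least[of "N + n"] decseqD[OF dec, of N "N + n"] by simp
    have "strict_mono (\<lambda>n. g (N + n))"
      using g by (auto simp: strict_mono_def)
    moreover have "mono (s \<circ> (\<lambda>n. g (N + n)))"
      by (rule monoI) (simp add: const)
    ultimately show ?thesis by blast
  qed
qed

text \<open>One function is treated at a time: refining a subsequence keeps the monotonicity already reached.\<close>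

lemma dickson_subsequence:
  fixes x :: "nat \<Rightarrow> 'a" and Fs :: "('a \<Rightarrow> nat) set"
  assumes "finite Fs"
  shows "\<exists>r :: nat \<Rightarrow> nat. strict_mono r \<and> (\<forall>f\<in>Fs. mono (f \<circ> x \<circ> r))"
  using assms
proof (induction Fs)
  case empty
  show ?case by (rule exI[of _ id]) (auto simp: strict_mono_def)
next
  case (insert f Fs)
  then obtain r :: "nat \<Rightarrow> nat" where r: "strict_mono r" "\<forall>f\<in>Fs. mono (f \<circ> x \<circ> r)" by blast
  obtain q :: "nat \<Rightarrow> nat" where q: "strict_mono q" "mono ((f \<circ> x \<circ> r) \<circ> q)"
    using nat_seq_mono_subseq[of "f \<circ> x \<circ> r"] by blast
  have mq: "mono q" using q(1) by (rule strict_mono_mono)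
  have "strict_mono (r \<circ> q)" using r q by (simp add: strict_mono_o)
  moreover have "\<forall>h\<in>insert f Fs. mono (h \<circ> x \<circ> (r \<circ> q))"
    using r(2) q(2) mq by (auto simp: mono_def)
  ultimately show ?case by blast
qed

text \<open>Dickson's lemma in the form that yields finiteness: the elements of \<open>X\<close> are compared through
  finitely many natural-number measurements, and distinct elements are incomparable.\<close>

lemma finite_if_antichain:
  fixes X :: "'a set" and Fs :: "('a \<Rightarrow> nat) set"
  assumes "finite Fs"
    and anti: "\<And>u v. u \<in> X \<Longrightarrow> v \<in> X \<Longrightarrow> (\<And>f. f \<in> Fs \<Longrightarrow> f u \<le> f v) \<Longrightarrow> u = v"
  shows "finite X"
proof (rule ccontr)
  assume "infinite X"
  then obtain x :: "nat \<Rightarrow> 'a" where x: "inj x" "range x \<subseteq> X"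
    by (meson infinite_countable_subset)
  obtain r :: "nat \<Rightarrow> nat" where r: "strict_mono r" "\<forall>f\<in>Fs. mono (f \<circ> x \<circ> r)"
    using dickson_subsequence[OF assms(1)] by blast
  have "x (r 0) = x (r 1)"
  proof (rule anti)
    show "x (r 0) \<in> X" "x (r 1) \<in> X" using x(2) by auto
    show "f (x (r 0)) \<le> f (x (r 1))" if "f \<in> Fs" for f
      using r(2) that by (auto simp: mono_def)
  qed
  then show False
    using x(1) r(1) by (metis injD strict_mono_eq zero_neq_one)
qed

definition irreducibles :: "nat \<Rightarrow> int vec set \<Rightarrow> int vec set" where
  "irreducibles d M = {v \<in> M. v \<noteq> 0\<^sub>v d \<and>
     (\<forall>u\<in>M. \<forall>w\<in>M. v = u + w \<longrightarrow> u = 0\<^sub>v d \<or> w = 0\<^sub>v d)}"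

lemma int_comb_closed:
  assumes "F \<subseteq> carrier_vec d"
  shows "finsum_vec TYPE(int) d (\<lambda>h. int (a h) \<cdot>\<^sub>v h) F \<in> carrier_vec d"
  using assms by (intro finsum_vec_closed) auto

lemma int_comb_index:
  assumes "finite F" "F \<subseteq> carrier_vec d" "i < d"
  shows "finsum_vec TYPE(int) d (\<lambda>h. int (a h) \<cdot>\<^sub>v h) F $ i = (\<Sum>h\<in>F. int (a h) * h $ i)"
proof -
  have "finsum_vec TYPE(int) d (\<lambda>h. int (a h) \<cdot>\<^sub>v h) F $ i = (\<Sum>h\<in>F. (int (a h) \<cdot>\<^sub>v h) $ i)"
    using assms by (intro index_finsum_vec) auto
  also have "\<dots> = (\<Sum>h\<in>F. int (a h) * h $ i)"
    using assms by (intro sum.cong) auto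
  finally show ?thesis .
qed

lemma zero_in_nonneg_int_combs: "0\<^sub>v d \<in> nonneg_int_combs d H"
  unfolding nonneg_int_combs_def
  by (rule CollectI, rule exI[of _ "\<lambda>_. 0"], rule exI[of _ "{}"]) (auto simp: finsum_vec_empty)

lemma generator_in_nonneg_int_combs:
  assumes "h \<in> H" "H \<subseteq> carrier_vec d"
  shows "h \<in> nonneg_int_combs d H"
proof -
  have hc: "h \<in> carrier_vec d" using assms by auto
  have "h = finsum_vec TYPE(int) d (\<lambda>h. int 1 \<cdot>\<^sub>v h) {h}"
  proof (rule eq_vecI)
    show dim: "dim_vec h = dim_vec (finsum_vec TYPE(int) d (\<lambda>h. int 1 \<cdot>\<^sub>v h) {h})"
      using int_comb_closed[of "{h}" d "\<lambda>_. 1"] hc by auto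
    fix i assume "i < dim_vec (finsum_vec TYPE(int) d (\<lambda>h. int 1 \<cdot>\<^sub>v h) {h})"
    then have "i < d" using dim hc by auto
    then show "h $ i = finsum_vec TYPE(int) d (\<lambda>h. int 1 \<cdot>\<^sub>v h) {h} $ i"
      using int_comb_index[of "{h}" d i "\<lambda>_. 1"] hc by auto
  qed
  then show ?thesis
    unfolding nonneg_int_combs_def using assms(1)
    by (intro CollectI exI[of _ "\<lambda>_. 1"] exI[of _ "{h}"]) auto
qed

lemma nonneg_int_combs_add:
  assumes H: "H \<subseteq> carrier_vec d"
    and u: "u \<in> nonneg_int_combs d H" and v: "v \<in> nonneg_int_combs d H"
  shows "u + v \<in> nonneg_int_combs d H"
proof -
  let ?S = "\<lambda>a. finsum_vec TYPE(int) d (\<lambda>h. int (a h) \<cdot>\<^sub>v h)"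
  from u obtain a F where u: "u = ?S a F" "finite F" "F \<subseteq> H"
    unfolding nonneg_int_combs_def by auto
  from v obtain b G where v: "v = ?S b G" "finite G" "G \<subseteq> H"
    unfolding nonneg_int_combs_def by auto
  \<comment> \<open>coefficients extended by zero to the union of the two index sets\<close>
  define c where "c h = (if h \<in> F then a h else 0) + (if h \<in> G then b h else 0)" for h
  have cl: "u \<in> carrier_vec d" "v \<in> carrier_vec d" "?S c (F \<union> G) \<in> carrier_vec d"
    using int_comb_closed[of F d a] int_comb_closed[of G d b] int_comb_closed[of "F \<union> G" d c]
      u v H by auto
  have "u + v = ?S c (F \<union> G)"
  proof (rule eq_vecI)
    show "dim_vec (u + v) = dim_vec (?S c (F \<union> G))" using cl by auto
    fix i assume "i < dim_vec (?S c (F \<union> G))"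
    then have i: "i < d" using cl by auto
    have "(u + v) $ i = (\<Sum>h\<in>F. int (a h) * h $ i) + (\<Sum>h\<in>G. int (b h) * h $ i)"
      using cl i u v H int_comb_index[of F d i a] int_comb_index[of G d i b] by auto
    also have "(\<Sum>h\<in>F. int (a h) * h $ i) =
        (\<Sum>h\<in>F \<union> G. int (if h \<in> F then a h else 0) * h $ i)"
      using u(2) v(2) by (intro sum.mono_neutral_cong_left) auto
    also have "(\<Sum>h\<in>G. int (b h) * h $ i) =
        (\<Sum>h\<in>F \<union> G. int (if h \<in> G then b h else 0) * h $ i)"
      using u(2) v(2) by (intro sum.mono_neutral_cong_left) auto
    finally have "(u + v) $ i = (\<Sum>h\<in>F \<union> G. int (c h) * h $ i)"
      unfolding c_def of_nat_add distrib_right sum.distrib .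
    then show "(u + v) $ i = ?S c (F \<union> G) $ i"
      using int_comb_index[of "F \<union> G" d i c] u(2,3) v(2,3) H i by (metis finite_Un le_sup_iff subset_trans)
  qed
  then show ?thesis
    unfolding nonneg_int_combs_def using u v
    by (intro CollectI exI[of _ c] exI[of _ "F \<union> G"]) auto
qed

text \<open>A monoid of integer vectors with a grading that is positive off zero, which excludes units and allows
  induction.\<close>

locale graded_int_monoid =
  fixes d :: nat and M :: "int vec set" and \<phi> :: "int vec \<Rightarrow> nat"
  assumes M_carrier: "M \<subseteq> carrier_vec d"
    and zero_mem: "0\<^sub>v d \<in> M"
    and add_mem: "\<And>u v. u \<in> M \<Longrightarrow> v \<in> M \<Longrightarrow> u + v \<in> M"
    and grade_add: "\<And>u v. u \<in> M \<Longrightarrow> v \<in> M \<Longrightarrow> \<phi> (u + v) = \<phi> u + \<phi> v"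
    and grade_pos: "\<And>u. u \<in> M \<Longrightarrow> u \<noteq> 0\<^sub>v d \<Longrightarrow> 0 < \<phi> u"
begin

lemma nat_smult_mem: "h \<in> M \<Longrightarrow> int n \<cdot>\<^sub>v h \<in> M"
proof (induction n)
  case 0
  have "h \<in> carrier_vec d" using 0 M_carrier by auto
  then have "int 0 \<cdot>\<^sub>v h = 0\<^sub>v d" by auto
  then show ?case using zero_mem by simp
next
  case (Suc n)
  have "int (Suc n) \<cdot>\<^sub>v h = h + int n \<cdot>\<^sub>v h"
    by (auto simp: algebra_simps)
  then show ?case using Suc add_mem by simp
qed

lemma int_comb_mem:
  assumes "finite F" "F \<subseteq> M"
  shows "finsum_vec TYPE(int) d (\<lambda>h. int (a h) \<cdot>\<^sub>v h) F \<in> M"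
  using assms
proof (induction F)
  case empty
  then show ?case using zero_mem by (simp add: finsum_vec_empty)
next
  case (insert h F)
  have "(\<lambda>h. int (a h) \<cdot>\<^sub>v h) \<in> F \<rightarrow> carrier_vec d" "int (a h) \<cdot>\<^sub>v h \<in> carrier_vec d"
    using insert M_carrier by auto
  then show ?case
    using insert add_mem nat_smult_mem by (simp add: finsum_vec_insert)
qed

text \<open>Peel the summands off one at a time: irreducibility makes one of the two parts zero, so in the end
  a single summand with coefficient one remains.\<close>

lemma irreducible_comb_mem:
  assumes "finite F" "F \<subseteq> M"
    and "finsum_vec TYPE(int) d (\<lambda>h. int (a h) \<cdot>\<^sub>v h) F \<in> irreducibles d M"
  shows "finsum_vec TYPE(int) d (\<lambda>h. int (a h) \<cdot>\<^sub>v h) F \<in> F"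
  using assms
proof (induction F)
  case empty
  then show ?case by (simp add: finsum_vec_empty irreducibles_def)
next
  case (insert h F)
  let ?S = "finsum_vec TYPE(int) d (\<lambda>h. int (a h) \<cdot>\<^sub>v h)"
  have hM: "h \<in> M" and FM: "F \<subseteq> M" using insert by auto
  have hc: "h \<in> carrier_vec d" using hM M_carrier by auto
  have S: "?S (insert h F) = int (a h) \<cdot>\<^sub>v h + ?S F"
    by (rule finsum_vec_insert) (use insert FM hc M_carrier in auto)
  have SF: "?S F \<in> M" using int_comb_mem insert(1) FM by auto
  have SFc: "?S F \<in> carrier_vec d" using SF M_carrier by auto
  have irr: "?S (insert h F) \<in> irreducibles d M" by fact
  from irr have "int (a h) \<cdot>\<^sub>v h = 0\<^sub>v d \<or> ?S F = 0\<^sub>v d"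
    using S SF nat_smult_mem[OF hM] unfolding irreducibles_def by blast
  then show ?case
  proof
    assume "int (a h) \<cdot>\<^sub>v h = 0\<^sub>v d"
    then have "?S (insert h F) = ?S F" using S SFc by simp
    then show ?thesis using insert.IH[OF FM] irr by simp
  next
    assume "?S F = 0\<^sub>v d"
    then have Sh: "?S (insert h F) = int (a h) \<cdot>\<^sub>v h" using S hc by simp
    then have nz: "int (a h) \<cdot>\<^sub>v h \<noteq> 0\<^sub>v d" using irr by (auto simp: irreducibles_def)
    obtain n where n: "a h = Suc n"
      using nz hc by (cases "a h") auto
    have split: "?S (insert h F) = h + int n \<cdot>\<^sub>v h"
      unfolding Sh n by (auto simp: algebra_simps)
    then have "h = 0\<^sub>v d \<or> int n \<cdot>\<^sub>v h = 0\<^sub>v d"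
      using irr hM nat_smult_mem[OF hM] unfolding irreducibles_def by blast
    then have "int n \<cdot>\<^sub>v h = 0\<^sub>v d" using nz by auto
    then show ?thesis using split hc by simp
  qed
qed

lemma irreducibles_subset_generators:
  assumes "H \<subseteq> M" "M \<subseteq> nonneg_int_combs d H"
  shows "irreducibles d M \<subseteq> H"
proof
  fix v assume v: "v \<in> irreducibles d M"
  then have "v \<in> nonneg_int_combs d H" using assms(2) by (auto simp: irreducibles_def)
  then obtain a F where F: "v = finsum_vec TYPE(int) d (\<lambda>h. int (a h) \<cdot>\<^sub>v h) F"
      "finite F" "F \<subseteq> H"
    unfolding nonneg_int_combs_def by auto
  have "finsum_vec TYPE(int) d (\<lambda>h. int (a h) \<cdot>\<^sub>v h) F \<in> F"
    using irreducible_comb_mem[of F a] F v assms(1) by blast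
  then show "v \<in> H" using F by blast
qed

text \<open>Splitting a reducible element into two nonzero parts lowers the grade of both, so the splitting ends.\<close>

lemma irreducibles_generate: "M \<subseteq> nonneg_int_combs d (irreducibles d M)"
proof
  fix v assume "v \<in> M"
  then show "v \<in> nonneg_int_combs d (irreducibles d M)"
  proof (induction "\<phi> v" arbitrary: v rule: less_induct)
    case less
    have Hc: "irreducibles d M \<subseteq> carrier_vec d"
      using M_carrier by (auto simp: irreducibles_def)
    consider "v = 0\<^sub>v d" | "v \<in> irreducibles d M"
      | u w where "u \<in> M" "w \<in> M" "v = u + w" "u \<noteq> 0\<^sub>v d" "w \<noteq> 0\<^sub>v d"
      using less.prems unfolding irreducibles_def by blast
    then show ?case
    proof cases
      case 1
      then show ?thesis by (simp add: zero_in_nonneg_int_combs)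
    next
      case 2
      then show ?thesis using Hc by (rule generator_in_nonneg_int_combs)
    next
      case 3
      then have "\<phi> u < \<phi> v" "\<phi> w < \<phi> v"
        using grade_add grade_pos by fastforce+
      then show ?thesis
        using less.hyps 3 nonneg_int_combs_add[OF Hc] by auto
    qed
  qed
qed

text \<open>Every generating set contains the irreducible elements and these already generate, so they are the
  unique minimal generating set; this turns the definite description of the Hilbert basis into an
  explicit set.\<close>

lemma is_hilbert_basis_iff: "is_hilbert_basis d M H \<longleftrightarrow> H = irreducibles d M"
proof
  assume H: "is_hilbert_basis d M H"
  then have "irreducibles d M \<subseteq> H"
    using irreducibles_subset_generators by (auto simp: is_hilbert_basis_def)
  then show "H = irreducibles d M"
    using H irreducibles_generate unfolding is_hilbert_basis_def by blast
next
  have sub: "irreducibles d M \<subseteq> M" by (auto simp: irreducibles_def)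
  assume "H = irreducibles d M"
  then show "is_hilbert_basis d M H"
    using sub irreducibles_generate irreducibles_subset_generators
    unfolding is_hilbert_basis_def by blast
qed

lemma hilbert_basis_eq: "hilbert_basis d M = irreducibles d M"
  unfolding hilbert_basis_def is_hilbert_basis_iff by simp

end

definition cone_points :: "nat \<Rightarrow> int vec set \<Rightarrow> int vec set" where
  "cone_points d N = {z \<in> carrier_vec d. \<forall>a\<in>N. 0 \<le> a \<bullet> z}"

text \<open>Gordan's lemma. If \<open>u\<close> and \<open>v\<close> are irreducible and no defining inequality of the cone is
  larger at \<open>u\<close> than at \<open>v\<close>, then \<open>v - u\<close> lies in the cone again and \<open>v = u + (v - u)\<close> forces
  \<open>u = v\<close>. So the values of the inequalities make the irreducible elements an antichain.\<close>

lemma finite_irreducibles_cone_points: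
  assumes N: "finite N" "N \<subseteq> carrier_vec d"
  shows "finite (irreducibles d (cone_points d N))"
proof (rule finite_if_antichain[where Fs = "(\<lambda>a z. nat (a \<bullet> z)) ` N"])
  show "finite ((\<lambda>a z. nat (a \<bullet> z)) ` N)" using N by simp
  fix u v assume u: "u \<in> irreducibles d (cone_points d N)"
    and v: "v \<in> irreducibles d (cone_points d N)"
    and le: "\<And>f. f \<in> (\<lambda>a z. nat (a \<bullet> z)) ` N \<Longrightarrow> f u \<le> f v"
  have uM: "u \<in> cone_points d N" and vM: "v \<in> cone_points d N"
    using u v by (auto simp: irreducibles_def)
  have uc: "u \<in> carrier_vec d" and vc: "v \<in> carrier_vec d"
    using uM vM by (auto simp: cone_points_def)
  have "0 \<le> a \<bullet> (v - u)" if "a \<in> N" for a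
  proof -
    have "nat (a \<bullet> u) \<le> nat (a \<bullet> v)" using le that by blast
    moreover have "0 \<le> a \<bullet> v" using vM that by (simp add: cone_points_def)
    ultimately show ?thesis
      using scalar_prod_minus_distrib[of a d v u] that N uc vc by auto
  qed
  then have "v - u \<in> cone_points d N" using uc vc by (auto simp: cone_points_def)
  moreover have eq: "v = u + (v - u)" using uc vc by auto
  ultimately have "u = 0\<^sub>v d \<or> v - u = 0\<^sub>v d"
    using v uM unfolding irreducibles_def by blast
  moreover have "u \<noteq> 0\<^sub>v d" using u by (auto simp: irreducibles_def)
  ultimately have "v - u = 0\<^sub>v d" by simp
  then show "u = v" using eq uc by simp
qed

text \<open>Inside one orthant no cancellation can occur, so the sum of the absolute values of the entries is additive
  and serves as the grading.\<close>

lemma graded_orthant_monoid: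
  assumes N: "N \<subseteq> carrier_vec d" and K: "K \<subseteq> {..<d}"
  shows "graded_int_monoid d (cone_points d N \<inter> orthant d K) (\<lambda>z. nat (\<Sum>i<d. \<bar>z $ i\<bar>))"
proof
  let ?M = "cone_points d N \<inter> orthant d K"
  show "?M \<subseteq> carrier_vec d" by (auto simp: cone_points_def)
  show "0\<^sub>v d \<in> ?M"
    using N K by (auto simp: cone_points_def orthant_def)
  fix u v assume u: "u \<in> ?M" and v: "v \<in> ?M"
  have uc: "u \<in> carrier_vec d" and vc: "v \<in> carrier_vec d"
    using u v by (auto simp: cone_points_def)
  have "0 \<le> a \<bullet> (u + v)" if "a \<in> N" for a
    using that u v uc vc N scalar_prod_add_distrib[of a d u v] by (auto simp: cone_points_def)
  moreover have "0 \<le> (u + v) $ i" if "i \<in> K" for i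
    using that u v uc vc K by (auto simp: orthant_def)
  moreover have "(u + v) $ i \<le> 0" if "i \<in> {..<d} - K" for i
    using that u v uc vc by (auto simp: orthant_def add_nonpos_nonpos)
  ultimately show "u + v \<in> ?M"
    using uc vc by (auto simp: cone_points_def orthant_def)
  have "\<bar>(u + v) $ i\<bar> = \<bar>u $ i\<bar> + \<bar>v $ i\<bar>" if "i < d" for i
  proof (cases "i \<in> K")
    case True
    then show ?thesis using that u v uc vc by (auto simp: orthant_def)
  next
    case False
    then have "u $ i \<le> 0" "v $ i \<le> 0" using that u v by (auto simp: orthant_def)
    then show ?thesis using that uc vc by auto
  qed
  then have "(\<Sum>i<d. \<bar>(u + v) $ i\<bar>) = (\<Sum>i<d. \<bar>u $ i\<bar>) + (\<Sum>i<d. \<bar>v $ i\<bar>)"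
    by (simp add: sum.distrib)
  then show "nat (\<Sum>i<d. \<bar>(u + v) $ i\<bar>) = nat (\<Sum>i<d. \<bar>u $ i\<bar>) + nat (\<Sum>i<d. \<bar>v $ i\<bar>)"
    by (simp add: nat_add_distrib sum_nonneg)
next
  let ?M = "cone_points d N \<inter> orthant d K"
  fix u assume u: "u \<in> ?M" "u \<noteq> 0\<^sub>v d"
  then have uc: "u \<in> carrier_vec d" by (auto simp: cone_points_def)
  obtain i where i: "i < d" "u $ i \<noteq> 0"
    using u(2) uc by (metis carrier_vecD eq_vecI index_zero_vec)
  have "0 < (\<Sum>i<d. \<bar>u $ i\<bar>)"
    using i by (intro sum_pos2[of _ i]) auto
  then show "0 < nat (\<Sum>i<d. \<bar>u $ i\<bar>)" by simp
qed

text \<open>The sets of integer points of polyhedral cones given by finitely many integer inequalities, as a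
  predicate with closure properties, so that \<open>C\<^sup>S\<close> and the orthants can be recognised as such
  without writing down their inequalities.\<close>

definition rational_cone_points :: "nat \<Rightarrow> int vec set \<Rightarrow> bool" where
  "rational_cone_points d M \<longleftrightarrow> (\<exists>N. finite N \<and> N \<subseteq> carrier_vec d \<and> M = cone_points d N)"

lemma rational_cone_points_INT:
  assumes "finite I" "\<And>i. i \<in> I \<Longrightarrow> rational_cone_points d {z \<in> carrier_vec d. P i z}"
  shows "rational_cone_points d {z \<in> carrier_vec d. \<forall>i\<in>I. P i z}"
proof -
  from assms(2) obtain N where N: "\<And>i. i \<in> I \<Longrightarrow> finite (N i) \<and> N i \<subseteq> carrier_vec d \<and>
      {z \<in> carrier_vec d. P i z} = cone_points d (N i)"
    unfolding rational_cone_points_def by metis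
  have P: "P i z \<longleftrightarrow> (\<forall>a\<in>N i. 0 \<le> a \<bullet> z)" if "i \<in> I" "z \<in> carrier_vec d" for i z
    using N[OF that(1)] that(2) unfolding cone_points_def by blast
  have "{z \<in> carrier_vec d. \<forall>i\<in>I. P i z} = cone_points d (\<Union>i\<in>I. N i)"
    unfolding cone_points_def using P by auto
  then show ?thesis
    unfolding rational_cone_points_def using N assms(1)
    by (intro exI[of _ "\<Union>i\<in>I. N i"]) auto
qed

lemma rational_cone_points_Int:
  assumes "rational_cone_points d M" "rational_cone_points d M'"
  shows "rational_cone_points d (M \<inter> M')"
proof -
  obtain N N' where "finite N" "N \<subseteq> carrier_vec d" "M = cone_points d N"
      "finite N'" "N' \<subseteq> carrier_vec d" "M' = cone_points d N'"
    using assms unfolding rational_cone_points_def by blast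
  then show ?thesis
    unfolding rational_cone_points_def
    by (intro exI[of _ "N \<union> N'"]) (auto simp: cone_points_def)
qed

lemma rational_cone_points_ge:
  assumes "a \<in> carrier_vec d"
  shows "rational_cone_points d {z \<in> carrier_vec d. 0 \<le> a \<bullet> z}"
  unfolding rational_cone_points_def cone_points_def
  using assms by (intro exI[of _ "{a}"]) auto

lemma rational_cone_points_le:
  assumes "a \<in> carrier_vec d"
  shows "rational_cone_points d {z \<in> carrier_vec d. a \<bullet> z \<le> 0}"
  unfolding rational_cone_points_def cone_points_def
  using assms by (intro exI[of _ "{- a}"]) auto

lemma rational_cone_points_orthant:
  assumes "K \<subseteq> {..<d}"
  shows "rational_cone_points d (orthant d K)"
proof -
  have "rational_cone_points d {z \<in> carrier_vec d. \<forall>i\<in>K. 0 \<le> z $ i}"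
  proof (rule rational_cone_points_INT)
    show "finite K" using assms finite_subset by blast
    fix i assume "i \<in> K"
    then have "{z \<in> carrier_vec d. 0 \<le> z $ i} = {z \<in> carrier_vec d. 0 \<le> (unit_vec d i :: int vec) \<bullet> z}"
      using assms by auto
    then show "rational_cone_points d {z \<in> carrier_vec d. 0 \<le> z $ i}"
      using rational_cone_points_ge[of "unit_vec d i"] by simp
  qed
  moreover have "rational_cone_points d {z \<in> carrier_vec d. \<forall>i\<in>{..<d} - K. z $ i \<le> 0}"
  proof (rule rational_cone_points_INT)
    fix i assume "i \<in> {..<d} - K"
    then have "{z \<in> carrier_vec d. z $ i \<le> 0} = {z \<in> carrier_vec d. (unit_vec d i :: int vec) \<bullet> z \<le> 0}"
      by auto
    then show "rational_cone_points d {z \<in> carrier_vec d. z $ i \<le> 0}"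
      using rational_cone_points_le[of "unit_vec d i"] by simp
  qed simp
  moreover have "orthant d K = {z \<in> carrier_vec d. \<forall>i\<in>K. 0 \<le> z $ i} \<inter>
      {z \<in> carrier_vec d. \<forall>i\<in>{..<d} - K. z $ i \<le> 0}"
    by (auto simp: orthant_def)
  ultimately show ?thesis using rational_cone_points_Int by simp
qed

text \<open>The part of a rational cone inside an orthant is pointed, so that its Hilbert basis exists and is unique.\<close>

lemma hilbert_basis_orthant:
  assumes M: "rational_cone_points d M" and K: "K \<subseteq> {..<d}"
  shows "finite (hilbert_basis d (M \<inter> orthant d K))"
    and "hilbert_basis d (M \<inter> orthant d K) \<subseteq> M \<inter> orthant d K"
    and "M \<inter> orthant d K \<subseteq> nonneg_int_combs d (hilbert_basis d (M \<inter> orthant d K))"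
proof -
  let ?M = "M \<inter> orthant d K"
  obtain N where N: "N \<subseteq> carrier_vec d" "M = cone_points d N"
    using M unfolding rational_cone_points_def by blast
  interpret graded_int_monoid d ?M "\<lambda>z. nat (\<Sum>i<d. \<bar>z $ i\<bar>)"
    unfolding N(2) using graded_orthant_monoid[OF N(1) K] .
  have "rational_cone_points d ?M"
    using M K rational_cone_points_Int rational_cone_points_orthant by blast
  then show "finite (hilbert_basis d ?M)"
    unfolding hilbert_basis_eq rational_cone_points_def
    using finite_irreducibles_cone_points by auto
  show "hilbert_basis d ?M \<subseteq> ?M"
    unfolding hilbert_basis_eq by (auto simp: irreducibles_def)
  show "?M \<subseteq> nonneg_int_combs d (hilbert_basis d ?M)"
    unfolding hilbert_basis_eq by (rule irreducibles_generate)
qed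

lemma nonneg_int_combs_positive:
  assumes H: "H \<subseteq> carrier_vec d" and z: "z \<in> nonneg_int_combs d H"
  obtains a F where "finite F" "F \<subseteq> H" "\<And>h. h \<in> F \<Longrightarrow> 1 \<le> a h"
    "z = finsum_vec TYPE(int) d (\<lambda>h. int (a h) \<cdot>\<^sub>v h) F"
proof -
  let ?S = "\<lambda>a. finsum_vec TYPE(int) d (\<lambda>h. int (a h) \<cdot>\<^sub>v h)"
  obtain a F where F: "z = ?S a F" "finite F" "F \<subseteq> H"
    using z unfolding nonneg_int_combs_def by auto
  define F' where "F' = {h\<in>F. 1 \<le> a h}"
  have F': "F' \<subseteq> F" "finite F'" using F(2) by (auto simp: F'_def)
  have Fc: "F \<subseteq> carrier_vec d" "F' \<subseteq> carrier_vec d" using F F' H by auto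
  have "?S a F = ?S a F'"
  proof (rule eq_vecI)
    show "dim_vec (?S a F) = dim_vec (?S a F')"
      using int_comb_closed[OF Fc(1), of a] int_comb_closed[OF Fc(2), of a] by simp
    fix i assume "i < dim_vec (?S a F')"
    then have i: "i < d" using int_comb_closed[OF Fc(2), of a] by simp
    show "?S a F $ i = ?S a F' $ i"
      unfolding int_comb_index[OF F(2) Fc(1) i] int_comb_index[OF F'(2) Fc(2) i]
      using F(2) F'(1) by (intro sum.mono_neutral_right) (auto simp: F'_def)
  qed
  then show ?thesis using that[of F' a] F F' by (auto simp: F'_def)
qed

section \<open>Circuits\<close>

lemma rmat_mult_rvec:
  assumes "A \<in> carrier_mat m n" "v \<in> carrier_vec n"
  shows "rmat A *\<^sub>v rvec v = rvec (A *\<^sub>v v)"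
  by (rule of_int_hom.mult_mat_vec_hom[OF assms, symmetric])

lemma mult_mat_vec_smult:
  fixes A :: "'a :: comm_ring_1 mat"
  assumes "A \<in> carrier_mat m n" "v \<in> carrier_vec n"
  shows "A *\<^sub>v (k \<cdot>\<^sub>v v) = k \<cdot>\<^sub>v (A *\<^sub>v v)"
  using assms by (intro eq_vecI) auto

lemma rvec_zero: "rvec (0\<^sub>v n) = 0\<^sub>v n"
  by (simp add: vec_eq_iff)

lemma rvec_eq_iff: "rvec u = rvec v \<longleftrightarrow> u = v"
  by (auto simp: vec_eq_iff)

lemma vec_supp_rvec: "vec_supp (rvec v) = vec_supp v"
  by (auto simp: vec_supp_def)

lemma vec_set_smult: "set\<^sub>v (k \<cdot>\<^sub>v v) = (*) k ` set\<^sub>v v"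
  unfolding vec_set_def image_image by (rule image_cong) auto

lemma finite_vec_supp: "finite (vec_supp v)"
  by (auto simp: vec_supp_def)

lemma vec_supp_eq_empty_iff: "v \<in> carrier_vec n \<Longrightarrow> vec_supp v = {} \<longleftrightarrow> v = 0\<^sub>v n"
  by (auto simp: vec_supp_def vec_eq_iff)

text \<open>A \<open>\<rat>\<close>-linear map on \<open>\<real>\<close> may be prescribed at \<open>x\<close>, since \<open>{x}\<close> extends to a Hamel basis.\<close>

lemma additive_real_to_rat:
  assumes "x \<noteq> (0::real)"
  obtains f :: "real \<Rightarrow> rat" where "additive f" "f x \<noteq> 0"
proof -
  interpret vector_space_pair "\<lambda>(q::rat) (r::real). of_rat q * r" "\<lambda>(q::rat) (r::rat). q * r"
    by unfold_locales (auto simp: algebra_simps of_rat_add of_rat_mult)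
  have "vs1.independent {x}"
    using assms by (simp add: vs1.dependent_single)
  from linear_independent_extend[OF this, of "\<lambda>_. 1"]
  obtain g where g: "Vector_Spaces.linear (\<lambda>(q::rat) (r::real). of_rat q * r) (*) g" "g x = 1"
    by auto
  show ?thesis
  proof (rule that)
    show "additive g" by unfold_locales (simp add: linear_add[OF g(1)])
    show "g x \<noteq> 0" using g by simp
  qed
qed

lemma additive_of_int_mult:
  assumes "additive (f :: real \<Rightarrow> rat)"
  shows "f (of_int k * x) = of_int k * f x"
proof -
  interpret additive f by fact
  have nat: "f (of_nat n * x) = of_nat n * f x" for n
    by (induction n) (simp_all add: zero add algebra_simps)
  show ?thesis
  proof (cases "0 \<le> k")
    case True
    then show ?thesis using nat[of "nat k"] by simp
  next
    case False
    then show ?thesis using nat[of "nat (- k)"] by (simp add: minus)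
  qed
qed

lemma common_denominator:
  fixes q :: "nat \<Rightarrow> rat"
  obtains D :: int and p :: "nat \<Rightarrow> int" where "0 < D" "\<And>j. j < n \<Longrightarrow> of_int D * q j = of_int (p j)"
proof -
  have "\<exists>D p. 0 < D \<and> (\<forall>j<n. of_int D * q j = of_int (p j))"
  proof (induction n)
    case 0
    show ?case by (rule exI[of _ 1]) simp
  next
    case (Suc n)
    then obtain D p where D: "(0::int) < D" "\<And>j. j < n \<Longrightarrow> of_int D * q j = of_int (p j)" by blast
    obtain a b where ab: "quotient_of (q n) = (a, b)" by fastforce
    then have b: "0 < b" "q n = of_int a / of_int b"
      using quotient_of_denom_pos quotient_of_div by auto
    have "of_int (D * b) * q j = of_int (if j = n then D * a else p j * b)" if "j < Suc n" for j
    proof (cases "j = n")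
      case True
      then show ?thesis using b by simp
    next
      case False
      then have "of_int D * q j = of_int (p j)" using D(2) that by simp
      then show ?thesis using False by (simp add: mult.commute mult.left_commute)
    qed
    then show ?case
      using D(1) b(1) by (intro exI[of _ "D * b"] exI[of _ "\<lambda>j. if j = n then D * a else p j * b"]) auto
  qed
  then show ?thesis using that by blast
qed

text \<open>An additive map \<open>\<real> \<rightarrow> \<rat>\<close>, applied to each coordinate, commutes with an integer matrix.
  It therefore sends a real kernel vector to a rational kernel vector without enlarging its support,
  and the result is nonzero if the map does not vanish on some chosen nonzero coordinate. Clearing
  denominators gives an integer vector.\<close>

lemma int_kernel_vector_below_real:
  assumes A: "A \<in> carrier_mat m n" and w: "w \<in> carrier_vec n" "w \<noteq> 0\<^sub>v n"
    and ker: "rmat A *\<^sub>v w = 0\<^sub>v m"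
  obtains v where "v \<in> carrier_vec n" "v \<noteq> 0\<^sub>v n" "A *\<^sub>v v = 0\<^sub>v m" "vec_supp v \<subseteq> vec_supp w"
proof -
  obtain i where i: "i < n" "w $ i \<noteq> 0"
    using w by (metis carrier_vecD eq_vecI index_zero_vec)
  obtain f :: "real \<Rightarrow> rat" where f: "additive f" "f (w $ i) \<noteq> 0"
    using additive_real_to_rat[OF i(2)] .
  interpret f: additive f by fact
  obtain D p where D: "(0::int) < D" "\<And>j. j < n \<Longrightarrow> of_int D * f (w $ j) = of_int (p j)"
    using common_denominator[of n "\<lambda>j. f (w $ j)"] by metis
  define v where "v = vec n p"
  have v: "v \<in> carrier_vec n" by (simp add: v_def)
  have "A *\<^sub>v v = 0\<^sub>v m"
  proof (rule eq_vecI)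
    fix r assume "r < dim_vec (0\<^sub>v m)"
    then have r: "r < m" by simp
    have "(rmat A *\<^sub>v w) $ r = (\<Sum>j = 0..<n. of_int (A $$ (r, j)) * w $ j)"
      using A w r by (auto simp: scalar_prod_def)
    then have zero: "(\<Sum>j = 0..<n. of_int (A $$ (r, j)) * w $ j) = 0"
      using ker r by simp
    have "of_int ((A *\<^sub>v v) $ r) = (\<Sum>j = 0..<n. of_int (A $$ (r, j)) * (of_int (p j) :: rat))"
      using A v r by (auto simp: scalar_prod_def v_def)
    also have "\<dots> = (\<Sum>j = 0..<n. of_int D * (of_int (A $$ (r, j)) * f (w $ j)))"
      using D(2) by (intro sum.cong) (auto simp: mult.left_commute simp flip: D(2))
    also have "\<dots> = of_int D * f (\<Sum>j = 0..<n. of_int (A $$ (r, j)) * w $ j)"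
      by (simp add: f.sum additive_of_int_mult[OF f(1)] sum_distrib_left)
    also have "\<dots> = 0" using zero by (simp add: f.zero)
    finally show "(A *\<^sub>v v) $ r = 0\<^sub>v m $ r" using r by simp
  qed (use A in auto)
  moreover have "v $ i \<noteq> 0"
    using D(1) D(2)[OF i(1)] f(2) i(1) by (auto simp: v_def)
  then have "v \<noteq> 0\<^sub>v n" using i(1) by auto
  moreover have "vec_supp v \<subseteq> vec_supp w"
  proof
    fix j assume "j \<in> vec_supp v"
    then have j: "j < n" "p j \<noteq> 0" by (auto simp: vec_supp_def v_def)
    then have "w $ j \<noteq> 0" using D(2)[OF j(1)] f.zero by auto
    then show "j \<in> vec_supp w" using j w by (auto simp: vec_supp_def)
  qed
  ultimately show ?thesis using that v by blast
qed

lemma primitive_multiple: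
  fixes v :: "int vec"
  assumes v: "v \<in> carrier_vec n" "v \<noteq> 0\<^sub>v n"
  obtains g u where "g \<noteq> 0" "u \<in> carrier_vec n" "v = g \<cdot>\<^sub>v u" "Gcd (set\<^sub>v u) = 1"
proof -
  define g where "g = Gcd (set\<^sub>v v)"
  define u where "u = vec n (\<lambda>j. v $ j div g)"
  obtain i where i: "i < n" "v $ i \<noteq> 0"
    using v by (metis carrier_vecD eq_vecI index_zero_vec)
  have dvd: "g dvd v $ j" if "j < n" for j
    unfolding g_def using that v by (intro Gcd_dvd) (auto simp: vec_set_def)
  have g: "g \<noteq> 0" using dvd[OF i(1)] i(2) by auto
  have u: "u \<in> carrier_vec n" by (simp add: u_def)
  have eq: "v = g \<cdot>\<^sub>v u"
    using v dvd by (auto simp: u_def vec_eq_iff)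
  have "set\<^sub>v v = (*) g ` set\<^sub>v u"
    unfolding eq by (rule vec_set_smult)
  then have "g = normalize (g * Gcd (set\<^sub>v u))"
    unfolding g_def[symmetric] using Gcd_mult[of g "set\<^sub>v u"] g_def by presburger
  moreover have "0 \<le> g" "0 \<le> Gcd (set\<^sub>v u)" by (simp_all add: g_def)
  ultimately have "g = g * Gcd (set\<^sub>v u)" by (simp only: normalize_int_def abs_of_nonneg mult_nonneg_nonneg)
  then have "Gcd (set\<^sub>v u) = 1" using g by simp
  then show ?thesis using that g u eq by blast
qed

text \<open>Take an integer kernel vector of least support size below \<open>w\<close> and make it primitive. Minimality
  against real kernel vectors follows since below each of them there is an integer one.\<close>

lemma circuit_below_kernel_vector:
  assumes A: "A \<in> carrier_mat m n" and w: "w \<in> carrier_vec n" "w \<noteq> 0\<^sub>v n"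
    and ker: "rmat A *\<^sub>v w = 0\<^sub>v m"
  obtains v where "v \<in> circuits A" "vec_supp v \<subseteq> vec_supp w"
proof -
  define P where "P v \<longleftrightarrow> v \<in> carrier_vec n \<and> v \<noteq> 0\<^sub>v n \<and> A *\<^sub>v v = 0\<^sub>v m \<and>
    vec_supp v \<subseteq> vec_supp w" for v
  have "\<exists>v. P v"
    using int_kernel_vector_below_real[OF A w ker] unfolding P_def by metis
  then obtain v where v: "P v" and least: "\<And>u. P u \<Longrightarrow> card (vec_supp v) \<le> card (vec_supp u)"
    using ex_has_least_nat[of P _ "\<lambda>v. card (vec_supp v)"] by blast
  obtain g u where u: "g \<noteq> 0" "u \<in> carrier_vec n" "v = g \<cdot>\<^sub>v u" "Gcd (set\<^sub>v u) = 1"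
    using primitive_multiple v unfolding P_def by metis
  have supp: "vec_supp u = vec_supp v" using u by (auto simp: vec_supp_def)
  have "g \<cdot>\<^sub>v (A *\<^sub>v u) = 0\<^sub>v m"
    using v u(3) mult_mat_vec_smult[OF A u(2), of g] unfolding P_def by simp
  then have Au: "A *\<^sub>v u = 0\<^sub>v m"
    using u(1) A by (auto simp: vec_eq_iff)
  have u0: "u \<noteq> 0\<^sub>v n"
    using v u(2,3) unfolding P_def by auto
  have "\<not> vec_supp x \<subset> vec_supp u"
    if x: "x \<in> carrier_vec n" "x \<noteq> 0\<^sub>v n" "rmat A *\<^sub>v x = 0\<^sub>v m" for x
  proof
    assume less: "vec_supp x \<subset> vec_supp u"
    obtain y where y: "y \<in> carrier_vec n" "y \<noteq> 0\<^sub>v n" "A *\<^sub>v y = 0\<^sub>v m" "vec_supp y \<subseteq> vec_supp x"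
      using int_kernel_vector_below_real[OF A x] .
    then have "P y" using less supp v unfolding P_def by blast
    then have "card (vec_supp u) \<le> card (vec_supp y)" using least supp by simp
    also have "\<dots> < card (vec_supp u)"
      using y(4) less finite_vec_supp by (intro psubset_card_mono) auto
    finally show False by simp
  qed
  then have "u \<in> circuits A"
    using A u(2,4) u0 Au unfolding circuits_def by (simp add: carrier_matD)
  then show ?thesis using that supp v unfolding P_def by blast
qed

lemma uminus_circuit:
  assumes "v \<in> circuits A"
  shows "- v \<in> circuits A"
proof -
  have v: "v \<in> carrier_vec (dim_col A)" "v \<noteq> 0\<^sub>v (dim_col A)"
    "A *\<^sub>v v = 0\<^sub>v (dim_row A)" "Gcd (set\<^sub>v v) = 1"
    using assms by (auto simp: circuits_def)
  have supp: "vec_supp (- v) = vec_supp v" by (auto simp: vec_supp_def)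
  have neg: "- v = (- 1) \<cdot>\<^sub>v v" by auto
  have gcd: "Gcd (set\<^sub>v (- v)) = 1"
    using v(4) by (simp add: neg vec_set_smult Gcd_mult)
  from neg have "A *\<^sub>v (- v) = 0\<^sub>v (dim_row A)"
    using mult_mat_vec_smult[of A "dim_row A" "dim_col A" v "- 1"] v by auto
  moreover have "- v \<noteq> 0\<^sub>v (dim_col A)" using v by (auto simp: vec_eq_iff)
  moreover have "- v \<in> carrier_vec (dim_col A)" using v by simp
  ultimately show ?thesis
    using assms supp gcd unfolding circuits_def by simp
qed

lemma kernel_sub_smult:
  fixes A :: "'a :: comm_ring_1 mat"
  assumes A: "A \<in> carrier_mat m n" and x: "x \<in> carrier_vec n" "A *\<^sub>v x = 0\<^sub>v m"
    and y: "y \<in> carrier_vec n" "A *\<^sub>v y = 0\<^sub>v m"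
  shows "A *\<^sub>v (a \<cdot>\<^sub>v x - b \<cdot>\<^sub>v y) = 0\<^sub>v m"
  using assms mult_minus_distrib_mat_vec[OF A, of "a \<cdot>\<^sub>v x" "b \<cdot>\<^sub>v y"]
    mult_mat_vec_smult[OF A x(1)] mult_mat_vec_smult[OF A y(1)] by (simp add: vec_eq_iff)

text \<open>Subtracting a suitable multiple of a circuit below \<open>w\<close> removes a coordinate from the support. A
  negative coefficient is absorbed by the opposite circuit.\<close>

lemma kernel_eq_circuit_combination:
  assumes A: "A \<in> carrier_mat m n" and w: "w \<in> carrier_vec n"
    and ker: "rmat A *\<^sub>v w = 0\<^sub>v m"
  shows "\<exists>(l::nat) \<sigma> \<beta>. (\<forall>i<l. \<sigma> i \<in> circuits A \<and> 0 \<le> \<beta> i) \<and>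
    (\<forall>j<n. w $ j = (\<Sum>i<l. \<beta> i * real_of_int (\<sigma> i $ j)))"
  using w ker
proof (induction "card (vec_supp w)" arbitrary: w rule: less_induct)
  case less
  show ?case
  proof (cases "w = 0\<^sub>v n")
    case True
    then show ?thesis by (intro exI[of _ 0]) auto
  next
    case False
    obtain v where v: "v \<in> circuits A" "vec_supp v \<subseteq> vec_supp w"
      using circuit_below_kernel_vector[OF A less.prems(1) False less.prems(2)] .
    have vc: "v \<in> carrier_vec n" "v \<noteq> 0\<^sub>v n" "A *\<^sub>v v = 0\<^sub>v m"
      using v A by (auto simp: circuits_def)
    obtain k where k: "k < n" "v $ k \<noteq> 0"
      using vc by (metis carrier_vecD eq_vecI index_zero_vec)
    define b where "b = w $ k / real_of_int (v $ k)"
    define w' where "w' = 1 \<cdot>\<^sub>v w - b \<cdot>\<^sub>v rvec v"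
    have w'c: "w' \<in> carrier_vec n" using less.prems(1) vc by (simp add: w'_def)
    have w'_idx: "w' $ j = w $ j - b * real_of_int (v $ j)" if "j < n" for j
      using that less.prems(1) vc by (simp add: w'_def)
    have "rmat A *\<^sub>v rvec v = 0\<^sub>v m"
      unfolding rmat_mult_rvec[OF A vc(1)] vc(3) by (rule rvec_zero)
    then have ker': "rmat A *\<^sub>v w' = 0\<^sub>v m"
      unfolding w'_def using A less.prems vc by (intro kernel_sub_smult[of _ m n]) auto
    have "vec_supp w' \<subseteq> vec_supp w"
    proof
      fix j assume j: "j \<in> vec_supp w'"
      then have jn: "j < n" using w'c by (auto simp: vec_supp_def)
      show "j \<in> vec_supp w"
      proof (rule ccontr)
        assume "j \<notin> vec_supp w"
        then have "w $ j = 0" "v $ j = 0"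
          using v(2) jn less.prems(1) vc(1) by (auto simp: vec_supp_def)
        then show False using j w'_idx[OF jn] by (simp add: vec_supp_def)
      qed
    qed
    moreover have "k \<in> vec_supp w"
      using v(2) k vc(1) by (auto simp: vec_supp_def)
    moreover have "k \<notin> vec_supp w'"
      using w'_idx[OF k(1)] k by (simp add: vec_supp_def b_def)
    ultimately have "card (vec_supp w') < card (vec_supp w)"
      using finite_vec_supp by (intro psubset_card_mono) auto
    from less.hyps[OF this w'c ker'] obtain l \<sigma> \<beta> where IH:
      "\<And>i. i < (l::nat) \<Longrightarrow> \<sigma> i \<in> circuits A \<and> 0 \<le> \<beta> i"
      "\<And>j. j < n \<Longrightarrow> w' $ j = (\<Sum>i<l. \<beta> i * real_of_int (\<sigma> i $ j))" by blast
    define s where "s = (if 0 \<le> b then v else - v)"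
    have s: "s \<in> circuits A" using v uminus_circuit by (simp add: s_def)
    have bs: "b * real_of_int (v $ j) = \<bar>b\<bar> * real_of_int (s $ j)" if "j < n" for j
      using that vc by (simp add: s_def)
    have "w $ j = (\<Sum>i<Suc l. (\<beta>(l := \<bar>b\<bar>)) i * real_of_int ((\<sigma>(l := s)) i $ j))" if "j < n" for j
      using IH(2)[OF that] w'_idx[OF that] bs[OF that] by simp
    moreover have "\<forall>i<Suc l. (\<sigma>(l := s)) i \<in> circuits A \<and> 0 \<le> (\<beta>(l := \<bar>b\<bar>)) i"
      using IH(1) s by (auto simp: less_Suc_eq)
    ultimately show ?thesis by blast
  qed
qed

lemma primitive_parallel:
  fixes u v :: "int vec"
  assumes c: "u \<in> carrier_vec n" "v \<in> carrier_vec n"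
    and gcd: "Gcd (set\<^sub>v u) = 1" "Gcd (set\<^sub>v v) = 1"
    and par: "a \<cdot>\<^sub>v u = b \<cdot>\<^sub>v v" and a: "a \<noteq> 0"
  shows "u = v \<or> u = - v"
proof -
  have "\<bar>a\<bar> = \<bar>b\<bar>"
    using arg_cong[OF par, of "\<lambda>x. Gcd (set\<^sub>v x)"] gcd by (simp add: vec_set_smult Gcd_mult)
  then consider "b = a" | "b = - a" by linarith
  then show ?thesis
  proof cases
    case 1
    then show ?thesis using par a c by (auto simp: vec_eq_iff)
  next
    case 2
    then have "a * (u $ i + v $ i) = 0" if "i < n" for i
      using arg_cong[OF par, of "\<lambda>x. x $ i"] that c by (simp add: distrib_left)
    then have "u = - v" using a c by (auto simp: vec_eq_iff eq_neg_iff_add_eq_0)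
    then show ?thesis ..
  qed
qed

text \<open>A combination of the two circuits that kills one coordinate has smaller support and hence vanishes,
  so the circuits are parallel; two parallel primitive vectors agree up to sign.\<close>

lemma circuits_same_support:
  assumes u: "u \<in> circuits A" and v: "v \<in> circuits A" and supp: "vec_supp u = vec_supp v"
  shows "u = v \<or> u = - v"
proof -
  let ?n = "dim_col A" and ?m = "dim_row A"
  have A: "A \<in> carrier_mat ?m ?n" by simp
  have uc: "u \<in> carrier_vec ?n" "u \<noteq> 0\<^sub>v ?n" "A *\<^sub>v u = 0\<^sub>v ?m" "Gcd (set\<^sub>v u) = 1"
    and vc: "v \<in> carrier_vec ?n" "v \<noteq> 0\<^sub>v ?n" "A *\<^sub>v v = 0\<^sub>v ?m" "Gcd (set\<^sub>v v) = 1"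
    using u v by (auto simp: circuits_def)
  obtain k where k: "k < ?n" "v $ k \<noteq> 0"
    using vc by (metis carrier_vecD eq_vecI index_zero_vec)
  \<comment> \<open>the combination of the two circuits that vanishes at \<open>k\<close>\<close>
  define x where "x = v $ k \<cdot>\<^sub>v u - u $ k \<cdot>\<^sub>v v"
  have xc: "x \<in> carrier_vec ?n" using uc vc by (simp add: x_def)
  have "A *\<^sub>v x = 0\<^sub>v ?m" unfolding x_def using kernel_sub_smult[OF A uc(1,3) vc(1,3)] .
  then have ker: "rmat A *\<^sub>v rvec x = 0\<^sub>v ?m"
    unfolding rmat_mult_rvec[OF A xc] by (simp add: rvec_zero)
  have "vec_supp x \<subseteq> vec_supp u"
  proof
    fix j assume j: "j \<in> vec_supp x"
    show "j \<in> vec_supp u"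
    proof (rule ccontr)
      assume "j \<notin> vec_supp u"
      then have "u $ j = 0" "v $ j = 0"
        using j supp xc uc vc by (auto simp: vec_supp_def)
      then show False using j xc uc vc by (auto simp: vec_supp_def x_def)
    qed
  qed
  moreover have "k \<in> vec_supp u" "k \<notin> vec_supp x"
    using supp k vc uc by (auto simp: vec_supp_def x_def)
  ultimately have "vec_supp (rvec x) \<subset> vec_supp u" by (auto simp: vec_supp_rvec)
  moreover have "\<forall>w\<in>carrier_vec ?n. w \<noteq> 0\<^sub>v ?n \<and> rmat A *\<^sub>v w = 0\<^sub>v ?m \<longrightarrow> \<not> vec_supp w \<subset> vec_supp u"
    using u by (simp add: circuits_def)
  moreover have "rvec x \<in> carrier_vec ?n" using xc by simp
  ultimately have "rvec x = 0\<^sub>v ?n" using ker by blast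
  then have x0: "x = 0\<^sub>v ?n" by (metis rvec_zero rvec_eq_iff)
  have "v $ k * u $ i = u $ k * v $ i" if "i < ?n" for i
  proof -
    have "x $ i = 0" using x0 that by simp
    then show ?thesis using that uc(1) vc(1) by (simp add: x_def)
  qed
  then have "v $ k \<cdot>\<^sub>v u = u $ k \<cdot>\<^sub>v v"
    using uc(1) vc(1) by (intro eq_vecI) auto
  then show ?thesis
    using primitive_parallel[OF uc(1) vc(1) uc(4) vc(4)] k by blast
qed

lemma finite_circuits: "finite (circuits A)"
proof -
  let ?C = "\<lambda>K. {v \<in> circuits A. vec_supp v = K}"
  have "finite (?C K)" for K
  proof (cases "?C K = {}")
    case True
    then show ?thesis by (metis finite.emptyI)
  next
    case False
    then obtain u where "u \<in> ?C K" by blast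
    then have "?C K \<subseteq> {u, - u}"
      using circuits_same_support[of _ A u] by auto
    then show ?thesis by (rule finite_subset) simp
  qed
  moreover have "circuits A = (\<Union>K\<in>Pow {..<dim_col A}. ?C K)"
    by (auto simp: circuits_def vec_supp_def)
  ultimately show ?thesis by (metis (no_types, lifting) finite_Pow_iff finite_UN_I finite_lessThan)
qed

section \<open>Bases\<close>

text \<open>Linear independence of the columns with index in \<open>J\<close>. Index sets instead of sets of vectors match
  the encoding of bases, and independence is stated through kernel vectors because these are the
  directions in which a non-basic point can be moved.\<close>

definition indep_cols :: "'a :: field mat \<Rightarrow> nat set \<Rightarrow> bool" where
  "indep_cols A J \<longleftrightarrow> J \<subseteq> {..<dim_col A} \<and>
     (\<forall>w\<in>carrier_vec (dim_col A). vec_supp w \<subseteq> J \<and> A *\<^sub>v w = 0\<^sub>v (dim_row A) \<longrightarrow> w = 0\<^sub>v (dim_col A))"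

lemma mult_mat_vec_supported:
  assumes A: "A \<in> carrier_mat m n" and J: "J \<subseteq> {..<n}"
    and w: "w \<in> carrier_vec n" "vec_supp w \<subseteq> J" and i: "i < m"
  shows "(A *\<^sub>v w) $ i = (\<Sum>j\<in>J. A $$ (i, j) * w $ j)"
proof -
  have "(A *\<^sub>v w) $ i = (\<Sum>j\<in>{0..<n}. A $$ (i, j) * w $ j)"
    using A w i by (auto simp: scalar_prod_def)
  also have "\<dots> = (\<Sum>j\<in>J. A $$ (i, j) * w $ j)"
    using J w by (intro sum.mono_neutral_right) (auto simp: vec_supp_def)
  finally show ?thesis .
qed

text \<open>This lemma and the next translate between index sets of columns and the sets of column vectors that
  the rank is defined by; repeated columns are excluded by injectivity.\<close>

lemma indep_cols_if_lin_indpt: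
  fixes A :: "'a :: field mat"
  assumes A: "A \<in> carrier_mat m n" and J: "J \<subseteq> {..<n}" and inj: "inj_on (col A) J"
    and li: "module.lin_indpt class_ring (module_vec TYPE('a) m) (col A ` J)"
  shows "indep_cols A J"
proof -
  interpret vec_space "TYPE('a)" m .
  have fin: "finite (col A ` J)" using J finite_subset by blast
  have cc: "col A ` J \<subseteq> carrier_vec m" using A by auto
  have zero: "w = 0\<^sub>v n" if w: "w \<in> carrier_vec n" "vec_supp w \<subseteq> J" "A *\<^sub>v w = 0\<^sub>v m" for w
  proof (rule ccontr)
    assume "w \<noteq> 0\<^sub>v n"
    then obtain k where k: "k < n" "w $ k \<noteq> 0"
      using w(1) by (metis carrier_vecD eq_vecI index_zero_vec)
    then have kJ: "k \<in> J" using w by (auto simp: vec_supp_def)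
    define a where "a v = w $ the_inv_into J (col A) v" for v
    have a: "a (col A j) = w $ j" if "j \<in> J" for j
      using that inj by (simp add: a_def the_inv_into_f_f)
    have "lincomb a (col A ` J) = 0\<^sub>v m"
    proof (rule eq_vecI)
      show "dim_vec (lincomb a (col A ` J)) = dim_vec (0\<^sub>v m)"
        using lincomb_dim[OF fin cc] by simp
      fix i assume "i < dim_vec (0\<^sub>v m)"
      then have i: "i < m" by simp
      have "lincomb a (col A ` J) $ i = (\<Sum>x\<in>col A ` J. a x * x $ i)"
        using lincomb_index[OF i cc] .
      also have "\<dots> = (\<Sum>j\<in>J. A $$ (i, j) * w $ j)"
        using A J i a by (subst sum.reindex[OF inj]) (auto intro!: sum.cong)
      also have "\<dots> = 0"
        using mult_mat_vec_supported[OF A J w(1,2) i] w(3) i by simp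
      finally show "lincomb a (col A ` J) $ i = 0\<^sub>v m $ i" using i by simp
    qed
    then have "lin_dep (col A ` J)"
      using lin_dep_crit[OF fin subset_refl, where a = a and v = "col A k"] kJ k a by auto
    then show False using li by blast
  qed
  show ?thesis
    unfolding indep_cols_def carrier_matD[OF A] using J zero by blast
qed

lemma lin_indpt_if_indep_cols:
  fixes A :: "'a :: field mat"
  assumes A: "A \<in> carrier_mat m n" and J: "indep_cols A J"
  shows "inj_on (col A) J"
    and "module.lin_indpt class_ring (module_vec TYPE('a) m) (col A ` J)"
proof -
  interpret vec_space "TYPE('a)" m .
  have Jn: "J \<subseteq> {..<n}" using A J by (simp add: indep_cols_def)
  have fin: "finite (col A ` J)" using Jn finite_subset by blast
  have cc: "col A ` J \<subseteq> carrier_vec m" using A by auto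
  have zero: "w = 0\<^sub>v n" if "w \<in> carrier_vec n" "vec_supp w \<subseteq> J" "A *\<^sub>v w = 0\<^sub>v m" for w
    using A J that by (simp add: indep_cols_def)
  show inj: "inj_on (col A) J"
  proof (rule inj_onI, rule ccontr)
    fix j k assume jk: "j \<in> J" "k \<in> J" "col A j = col A k" "j \<noteq> k"
    define w where "w = (unit_vec n j - unit_vec n k :: 'a vec)"
    have wc: "w \<in> carrier_vec n" by (simp add: w_def)
    have "A *\<^sub>v unit_vec n i = col A i" if "i < n" for i
      using A that by (intro eq_vecI) auto
    then have "A *\<^sub>v w = col A j - col A k"
      unfolding w_def using jk(1,2) Jn mult_minus_distrib_mat_vec[OF A, of "unit_vec n j" "unit_vec n k"]
      by (simp add: subset_iff)
    then have "A *\<^sub>v w = 0\<^sub>v m" using A jk by auto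
    moreover have "vec_supp w \<subseteq> J"
      using jk by (auto simp: vec_supp_def w_def unit_vec_def split: if_splits)
    ultimately have "w = 0\<^sub>v n" using zero wc by blast
    moreover have "w $ j = 1" using jk Jn by (simp add: w_def subset_iff)
    ultimately show False using jk(1) Jn by auto
  qed
  show "lin_indpt (col A ` J)"
  proof
    assume "lin_dep (col A ` J)"
    then obtain a v where a: "lincomb a (col A ` J) = 0\<^sub>v m" "v \<in> col A ` J" "a v \<noteq> 0"
      using finite_lin_dep[OF fin] cc by auto
    then obtain k where k: "k \<in> J" "a (col A k) \<noteq> 0" by blast
    define w where "w = vec n (\<lambda>j. if j \<in> J then a (col A j) else 0)"
    have wc: "w \<in> carrier_vec n" by (simp add: w_def)
    have ws: "vec_supp w \<subseteq> J" by (auto simp: vec_supp_def w_def split: if_splits)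
    have "A *\<^sub>v w = 0\<^sub>v m"
    proof (rule eq_vecI)
      fix i assume "i < dim_vec (0\<^sub>v m)"
      then have i: "i < m" by simp
      have "(A *\<^sub>v w) $ i = (\<Sum>j\<in>J. A $$ (i, j) * w $ j)"
        using mult_mat_vec_supported[OF A Jn wc ws i] .
      also have "\<dots> = (\<Sum>x\<in>col A ` J. a x * x $ i)"
        using A Jn i by (subst sum.reindex[OF inj]) (auto simp: w_def intro!: sum.cong)
      also have "\<dots> = 0" using lincomb_index[OF i cc, of a] a(1) i by simp
      finally show "(A *\<^sub>v w) $ i = 0\<^sub>v m $ i" using i by simp
    qed (use A in auto)
    then have "w = 0\<^sub>v n" using zero wc ws by blast
    moreover have "w $ k \<noteq> 0" using k Jn by (auto simp: w_def)
    ultimately show False using k Jn by auto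
  qed
qed

text \<open>A maximal independent index set gives a maximal independent set of column vectors, and the size of
  the latter is the rank.\<close>

lemma indep_cols_extend:
  fixes A :: "'a :: field mat"
  assumes A: "A \<in> carrier_mat m n" and rank: "vec_space.rank m A = m"
    and J: "indep_cols A J"
  obtains J' where "J \<subseteq> J'" "indep_cols A J'" "card J' = m"
proof -
  interpret vec_space "TYPE('a)" m .
  obtain J' where max: "maximal J' (indep_cols A)" and sub: "J \<subseteq> J'"
    using maximal_exists_superset[of "{..<n}" "indep_cols A" J] A J
    by (auto simp: indep_cols_def)
  have J': "indep_cols A J'" using max by (simp add: maximal_def)
  then have J'n: "J' \<subseteq> {..<n}" using A by (simp add: indep_cols_def)
  note li = lin_indpt_if_indep_cols[OF A J']
  have cols: "set (cols A) = col A ` {..<n}"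
    using A by (auto simp: cols_def)
  have "maximal (col A ` J') (\<lambda>T. T \<subseteq> set (cols A) \<and> lin_indpt T)"
    unfolding maximal_def
  proof (intro conjI allI impI)
    show "col A ` J' \<subseteq> set (cols A)" using J'n cols by auto
    show "lin_indpt (col A ` J')" using li by blast
    fix T assume T: "col A ` J' \<subseteq> T \<and> T \<subseteq> set (cols A) \<and> lin_indpt T"
    have T1: "col A ` J' \<subseteq> T" using T by (rule conjunct1)
    have T2: "T \<subseteq> col A ` {..<n}" using T cols by simp
    have T3: "lin_indpt T" using T by simp
    show "T = col A ` J'"
    proof (rule ccontr)
      assume "T \<noteq> col A ` J'"
      then obtain x where x: "x \<in> T" "x \<notin> col A ` J'" using T1 by blast
      then obtain j where "j < n" "x = col A j" using T2 by blast
      then have j: "j < n" "col A j \<in> T" "col A j \<notin> col A ` J'" using x by auto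
      have "lin_indpt (col A ` insert j J')"
        by (rule subset_li_is_li[OF T3]) (use T1 j in simp)
      moreover have "inj_on (col A) (insert j J')" using li(1) j by auto
      ultimately have "indep_cols A (insert j J')"
        using indep_cols_if_lin_indpt[OF A] j J'n by auto
      then have "insert j J' = J'" using max unfolding maximal_def by blast
      then show False using j by auto
    qed
  qed
  then have "card (col A ` J') = m"
    using rank_card_indpt[OF A] rank by simp
  then have "card J' = m" using card_image[OF li(1)] by simp
  then show ?thesis using that sub J' by blast
qed

lemma submatrix_UNIV_carrier:
  assumes "A \<in> carrier_mat m n" "J \<subseteq> {..<n}"
  shows "submatrix A UNIV J \<in> carrier_mat m (card J)"
proof -
  have "{j. j < n \<and> j \<in> J} = J" using assms by auto
  then show ?thesis using assms by (intro carrier_matI) (auto simp: dim_submatrix)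
qed

lemma submatrix_UNIV_index:
  assumes "A \<in> carrier_mat m n" "J \<subseteq> {..<n}" "i < m" "k < card J"
  shows "submatrix A UNIV J $$ (i, k) = A $$ (i, pick J k)"
proof -
  have "{j. j < n \<and> j \<in> J} = J" using assms by auto
  then show ?thesis using assms by (simp add: submatrix_index pick_UNIV)
qed

lemma bij_betw_pick:
  assumes "finite J"
  shows "bij_betw (pick J) {..<card J} J"
proof (rule bij_betw_byWitness[where f' = "\<lambda>j. card {i\<in>J. i < j}"])
  show "\<forall>k\<in>{..<card J}. card {i \<in> J. i < pick J k} = k" by (simp add: card_pick_le)
  show "\<forall>j\<in>J. pick J (card {i \<in> J. i < j}) = j" by (simp add: pick_card_in_set)
  show "pick J ` {..<card J} \<subseteq> J" by (auto simp: pick_in_set_le)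
  show "(\<lambda>j. card {i \<in> J. i < j}) ` J \<subseteq> {..<card J}"
    using assms by (auto intro!: psubset_card_mono)
qed

text \<open>On vectors supported on \<open>J\<close>, multiplication by \<open>A\<close> is multiplication by the submatrix of the columns in
  \<open>J\<close>, once the entries are renumbered by \<^const>\<open>pick\<close>; \<open>embed_vec\<close> below is the inverse renumbering.\<close>

lemma mult_mat_vec_submatrix:
  fixes A :: "'a :: comm_ring_1 mat"
  assumes A: "A \<in> carrier_mat m n" and J: "J \<subseteq> {..<n}"
    and w: "w \<in> carrier_vec n" "vec_supp w \<subseteq> J"
  shows "A *\<^sub>v w = submatrix A UNIV J *\<^sub>v vec (card J) (\<lambda>k. w $ pick J k)"
proof (rule eq_vecI)
  have S: "submatrix A UNIV J \<in> carrier_mat m (card J)"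
    using submatrix_UNIV_carrier[OF A J] .
  show "dim_vec (A *\<^sub>v w) = dim_vec (submatrix A UNIV J *\<^sub>v vec (card J) (\<lambda>k. w $ pick J k))"
    using A S by simp
  fix i assume "i < dim_vec (submatrix A UNIV J *\<^sub>v vec (card J) (\<lambda>k. w $ pick J k))"
  then have i: "i < m" using S by simp
  have fin: "finite J" using J finite_subset by blast
  have "(A *\<^sub>v w) $ i = (\<Sum>j\<in>J. A $$ (i, j) * w $ j)"
    using A w i J by (intro mult_mat_vec_supported)
  also have "\<dots> = (\<Sum>k\<in>{..<card J}. A $$ (i, pick J k) * w $ pick J k)"
    by (rule sum.reindex_bij_betw[OF bij_betw_pick[OF fin], symmetric])
  also have "\<dots> = (\<Sum>k\<in>{0..<card J}. submatrix A UNIV J $$ (i, k) * w $ pick J k)"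
    using submatrix_UNIV_index[OF A J i] by (intro sum.cong) auto
  also have "\<dots> = (submatrix A UNIV J *\<^sub>v vec (card J) (\<lambda>k. w $ pick J k)) $ i"
    using S i by (auto simp: scalar_prod_def)
  finally show "(A *\<^sub>v w) $ i = (submatrix A UNIV J *\<^sub>v vec (card J) (\<lambda>k. w $ pick J k)) $ i" .
qed

definition embed_vec :: "nat \<Rightarrow> nat set \<Rightarrow> 'a :: zero vec \<Rightarrow> 'a vec" where
  "embed_vec n J u = vec n (\<lambda>j. if j \<in> J then u $ card {i\<in>J. i < j} else 0)"

lemma embed_vec_carrier: "embed_vec n J u \<in> carrier_vec n"
  by (simp add: embed_vec_def)

lemma vec_supp_embed_vec: "vec_supp (embed_vec n J u) \<subseteq> J"
  by (auto simp: vec_supp_def embed_vec_def split: if_splits)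

lemma pick_embed_vec:
  assumes "J \<subseteq> {..<n}" "u \<in> carrier_vec (card J)"
  shows "vec (card J) (\<lambda>k. embed_vec n J u $ pick J k) = u"
proof (rule eq_vecI)
  fix k assume "k < dim_vec u"
  then have k: "k < card J" using assms by simp
  then have "pick J k \<in> J" by (rule pick_in_set_le)
  moreover from this have "pick J k < n" using assms by auto
  ultimately show "vec (card J) (\<lambda>k. embed_vec n J u $ pick J k) $ k = u $ k"
    using k by (simp add: embed_vec_def card_pick_le)
qed (use assms in simp)

lemma embed_pick_vec:
  assumes J: "J \<subseteq> {..<n}" and w: "w \<in> carrier_vec n" "vec_supp w \<subseteq> J"
  shows "embed_vec n J (vec (card J) (\<lambda>k. w $ pick J k)) = w"
proof (rule eq_vecI)
  fix j assume "j < dim_vec w"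
  then have j: "j < n" using w by simp
  have fin: "finite J" using J finite_subset by blast
  show "embed_vec n J (vec (card J) (\<lambda>k. w $ pick J k)) $ j = w $ j"
  proof (cases "j \<in> J")
    case True
    then have "card {i\<in>J. i < j} < card J" using fin by (auto intro!: psubset_card_mono)
    then show ?thesis using True j by (simp add: embed_vec_def pick_card_in_set)
  next
    case False
    then have "w $ j = 0" using w j by (auto simp: vec_supp_def)
    then show ?thesis using False j by (simp add: embed_vec_def)
  qed
qed (use w in \<open>simp add: embed_vec_def\<close>)

lemma invertible_mat_if_det_nonzero:
  fixes A :: "'a :: field mat"
  assumes A: "A \<in> carrier_mat n n" and det: "det A \<noteq> 0"
  shows "invertible_mat A"
proof -
  let ?B = "inverse (det A) \<cdot>\<^sub>m adj_mat A"
  have "A * ?B = 1\<^sub>m n" "?B * A = 1\<^sub>m n"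
    unfolding mult_smult_distrib[OF A adj_mat(1)[OF A]] mult_smult_assoc_mat[OF adj_mat(1)[OF A] A]
      adj_mat(2,3)[OF A] using det by (auto intro!: eq_matI)
  then show ?thesis
    using A adj_mat(1)[OF A] unfolding invertible_mat_def inverts_mat_def
    by (intro conjI exI[of _ ?B]) auto
qed

text \<open>The independent columns extend to \<open>m\<close> independent ones; a square matrix with trivial kernel is invertible.\<close>

lemma indep_cols_subset_basis:
  assumes A: "A \<in> carrier_mat m n" and rank: "vec_space.rank m (rmat A) = m"
    and J: "indep_cols (rmat A) J"
  obtains J' where "J' \<in> bases A" "J \<subseteq> J'"
proof -
  have rA: "rmat A \<in> carrier_mat m n" using A by simp
  obtain J' where J': "J \<subseteq> J'" "indep_cols (rmat A) J'" "card J' = m"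
    using indep_cols_extend[OF rA rank J] .
  have J'n: "J' \<subseteq> {..<n}" using J'(2) A by (simp add: indep_cols_def)
  let ?B = "basis_mat A J'"
  have B: "?B \<in> carrier_mat m m"
    using submatrix_UNIV_carrier[OF rA J'n] J'(3) by (simp add: basis_mat_def)
  have "v = 0\<^sub>v m" if v: "v \<in> carrier_vec m" "?B *\<^sub>v v = 0\<^sub>v m" for v
  proof -
    let ?w = "embed_vec n J' v"
    have "rmat A *\<^sub>v ?w = 0\<^sub>v m"
      using mult_mat_vec_submatrix[OF rA J'n embed_vec_carrier vec_supp_embed_vec, of v]
        pick_embed_vec[OF J'n, of v] v J'(3) by (simp add: basis_mat_def)
    moreover have "?w = 0\<^sub>v n" if "rmat A *\<^sub>v ?w = 0\<^sub>v m"
      using J'(2) A that embed_vec_carrier[of n J' v] vec_supp_embed_vec[of n J' v]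
      by (simp add: indep_cols_def)
    ultimately have "?w = 0\<^sub>v n" by blast
    then have "vec m (\<lambda>k. ?w $ pick J' k) = 0\<^sub>v m"
      using pick_in_set_le[of _ J'] J'n J'(3) by (auto simp: vec_eq_iff subset_iff)
    then show ?thesis using pick_embed_vec[OF J'n, of v] v J'(3) by simp
  qed
  then have "det ?B \<noteq> 0"
    using det_0_iff_vec_prod_zero_field[OF B] by blast
  then have "J' \<in> bases A"
    using A J'n J'(3) invertible_mat_if_det_nonzero[OF B] by (simp add: bases_def)
  then show ?thesis using that J'(1) by blast
qed

section \<open>Basis tableaux\<close>

lemma basis_mat_carrier:
  assumes AR: "AR \<in> carrier_mat m n" and J: "J \<in> bases AR"
  shows "J \<subseteq> {..<n}" and "card J = m" and "basis_mat AR J \<in> carrier_mat m m"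
proof -
  show J': "J \<subseteq> {..<n}" "card J = m" using J AR by (auto simp: bases_def)
  show "basis_mat AR J \<in> carrier_mat m m"
    using submatrix_UNIV_carrier[of "rmat AR" m n J] AR J' by (simp add: basis_mat_def)
qed

lemma basis_mat_inverse:
  assumes AR: "AR \<in> carrier_mat m n" and J: "J \<in> bases AR"
  obtains C where "mat_inverse (basis_mat AR J) = Some C" "C \<in> carrier_mat m m"
    "basis_mat AR J * C = 1\<^sub>m m" "C * basis_mat AR J = 1\<^sub>m m"
proof -
  let ?B = "basis_mat AR J"
  have Jn: "J \<subseteq> {..<n}" "card J = m" and inv: "invertible_mat ?B"
    using J AR by (auto simp: bases_def)
  have B: "?B \<in> carrier_mat m m"
    using submatrix_UNIV_carrier[of "rmat AR" m n J] AR Jn by (simp add: basis_mat_def)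
  obtain B' where B': "?B * B' = 1\<^sub>m m" "B' * ?B = 1\<^sub>m (dim_row B')"
    using inv B unfolding invertible_mat_def inverts_mat_def by auto
  have "dim_col B' = m" using arg_cong[OF B'(1), of dim_col] by simp
  moreover have "dim_row B' = m" using arg_cong[OF B'(2), of dim_col] B by simp
  ultimately have "B' \<in> carrier_mat m m" by (rule carrier_matI[rotated])
  then have "?B \<in> Units (ring_mat TYPE(real) m ())"
    using B B' by (auto simp: Units_def ring_mat_def)
  then obtain C where "mat_inverse ?B = Some C"
    using mat_inverse(1)[OF B, of "()"] by (cases "mat_inverse ?B") auto
  then show ?thesis using that mat_inverse(2)[OF B] by blast
qed

lemma basis_tableau_carrier:
  assumes AR: "AR \<in> carrier_mat m n" and AI: "AI \<in> carrier_mat m q" and J: "J \<in> bases AR"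
  shows "basis_tableau AR AI J \<in> carrier_mat m q"
proof -
  obtain C where "mat_inverse (basis_mat AR J) = Some C" "C \<in> carrier_mat m m"
    using basis_mat_inverse[OF AR J] by metis
  then show ?thesis using AI by (simp add: basis_tableau_def)
qed

text \<open>By Cramer's rule \<open>B\<^sup>-\<^sup>1\<close> is the integer matrix \<open>adj B\<close> divided by \<open>\<delta> = det B\<close>.\<close>

lemma basis_tableau_integral_multiple:
  assumes AR: "AR \<in> carrier_mat m n" and AI: "AI \<in> carrier_mat m q" and J: "J \<in> bases AR"
  obtains \<delta> :: int and R where "\<delta> \<noteq> 0" "R \<in> carrier_mat m q"
    "rmat R = of_int \<delta> \<cdot>\<^sub>m basis_tableau AR AI J"
proof -
  let ?B = "basis_mat AR J"
  define B0 where "B0 = submatrix AR UNIV J"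
  obtain C where C: "mat_inverse ?B = Some C" "C \<in> carrier_mat m m"
    "?B * C = 1\<^sub>m m" "C * ?B = 1\<^sub>m m"
    using basis_mat_inverse[OF AR J] by metis
  have Jn: "J \<subseteq> {..<n}" "card J = m" using J AR by (auto simp: bases_def)
  have B0: "B0 \<in> carrier_mat m m"
    using submatrix_UNIV_carrier[OF AR Jn(1)] Jn(2) by (simp add: B0_def)
  have rAR: "rmat AR \<in> carrier_mat m n" using AR by simp
  have B: "?B \<in> carrier_mat m m"
    using submatrix_UNIV_carrier[OF rAR Jn(1)] Jn(2) by (simp add: basis_mat_def)
  have rB0: "rmat B0 = ?B"
  proof (rule eq_matI)
    fix i j assume "i < dim_row ?B" "j < dim_col ?B"
    then have ij: "i < m" "j < card J" using B Jn(2) by auto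
    then have "pick J j < n" using pick_in_set_le[of j J] Jn(1) by auto
    then show "rmat B0 $$ (i, j) = ?B $$ (i, j)"
      using ij B0 AR submatrix_UNIV_index[OF AR Jn(1) ij] submatrix_UNIV_index[OF rAR Jn(1) ij]
      by (simp add: basis_mat_def B0_def[symmetric] Jn(2))
  qed (use B0 B in auto)
  define \<delta> where "\<delta> = det B0"
  have det: "det ?B = of_int \<delta>"
    unfolding rB0[symmetric] \<delta>_def by (rule of_int_hom.hom_det)
  have "det C * det ?B = 1"
    using det_mult[OF C(2) B] C(4) by simp
  then have d0: "\<delta> \<noteq> 0" using det by auto
  have adj: "adj_mat B0 \<in> carrier_mat m m" "adj_mat B0 * B0 = \<delta> \<cdot>\<^sub>m 1\<^sub>m m"
    using adj_mat[OF B0] by (auto simp: \<delta>_def)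
  have radj: "rmat (adj_mat B0) \<in> carrier_mat m m" using adj by simp
  have "rmat (adj_mat B0) * ?B = rmat (\<delta> \<cdot>\<^sub>m 1\<^sub>m m)"
    using of_int_hom.mat_hom_mult[OF adj(1) B0, where 'a = real] rB0 adj(2) by simp
  also have "\<dots> = of_int \<delta> \<cdot>\<^sub>m 1\<^sub>m m" by (auto intro!: eq_matI)
  finally have "rmat (adj_mat B0) * ?B * C = (of_int \<delta> \<cdot>\<^sub>m 1\<^sub>m m) * C" by simp
  then have adjC: "rmat (adj_mat B0) = of_int \<delta> \<cdot>\<^sub>m C"
    unfolding assoc_mult_mat[OF radj B C(2)] C(3)
    using radj C(2) mult_smult_assoc_mat[of "1\<^sub>m m" m m C m "real_of_int \<delta>"] by simp
  define R where "R = adj_mat B0 * AI"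
  have R: "R \<in> carrier_mat m q" using adj AI by (simp add: R_def)
  have "rmat R = rmat (adj_mat B0) * rmat AI"
    unfolding R_def by (rule of_int_hom.mat_hom_mult[OF adj(1) AI])
  also have "\<dots> = of_int \<delta> \<cdot>\<^sub>m (C * rmat AI)"
    unfolding adjC using mult_smult_assoc_mat[OF C(2), of "rmat AI" q] AI by simp
  also have "C * rmat AI = basis_tableau AR AI J"
    using C(1) by (simp add: basis_tableau_def)
  finally show ?thesis using that d0 R by blast
qed

lemma rvec_scalar_prod:
  assumes "u \<in> carrier_vec d" "v \<in> carrier_vec d"
  shows "rvec u \<bullet> rvec v = of_int (u \<bullet> v)"
  using assms by (auto simp: scalar_prod_def)

text \<open>The multiple \<open>\<delta>\<^sup>2\<close> is taken in place of \<open>\<delta>\<close> to have a positive factor, which preserves the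
  sign of the row.\<close>

lemma basis_tableau_row_integral:
  assumes AR: "AR \<in> carrier_mat m n" and AI: "AI \<in> carrier_mat m q"
    and J: "J \<in> bases AR" and p: "p < m"
  obtains D :: int and a where "0 < D" "a \<in> carrier_vec q"
    "\<And>z. z \<in> carrier_vec q \<Longrightarrow> of_int D * (row (basis_tableau AR AI J) p \<bullet> rvec z) = of_int (a \<bullet> z)"
proof -
  let ?T = "basis_tableau AR AI J"
  have T: "?T \<in> carrier_mat m q" using basis_tableau_carrier[OF AR AI J] .
  obtain \<delta> :: int and R where R: "\<delta> \<noteq> 0" "R \<in> carrier_mat m q" "rmat R = of_int \<delta> \<cdot>\<^sub>m ?T"
    using basis_tableau_integral_multiple[OF AR AI J] .
  have row: "rvec (row R p) = of_int \<delta> \<cdot>\<^sub>v row ?T p"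
  proof (rule eq_vecI)
    show "dim_vec (rvec (row R p)) = dim_vec (of_int \<delta> \<cdot>\<^sub>v row ?T p)"
      using R(2) T by simp
    fix j assume "j < dim_vec (of_int \<delta> \<cdot>\<^sub>v row ?T p)"
    then have j: "j < q" using T by simp
    have "rmat R $$ (p, j) = of_int \<delta> * ?T $$ (p, j)"
      unfolding R(3) using T p j by simp
    then show "rvec (row R p) $ j = (of_int \<delta> \<cdot>\<^sub>v row ?T p) $ j"
      using R(2) T p j by simp
  qed
  show ?thesis
  proof (rule that)
    show "0 < \<delta> * \<delta>" using R(1) by (simp add: zero_less_mult_iff) linarith
    have rc: "row R p \<in> carrier_vec q" using R(2) p by auto
    then show "\<delta> \<cdot>\<^sub>v row R p \<in> carrier_vec q" by simp
    fix z :: "int vec" assume z: "z \<in> carrier_vec q"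
    have Tc: "row ?T p \<in> carrier_vec q" using T p by auto
    have "of_int ((\<delta> \<cdot>\<^sub>v row R p) \<bullet> z) = of_int \<delta> * (rvec (row R p) \<bullet> rvec z)"
      using rc z rvec_scalar_prod[OF rc z] by simp
    also have "\<dots> = of_int (\<delta> * \<delta>) * (row ?T p \<bullet> rvec z)"
      unfolding row using Tc z by simp
    finally show "of_int (\<delta> * \<delta>) * (row ?T p \<bullet> rvec z) = of_int ((\<delta> \<cdot>\<^sub>v row R p) \<bullet> z)" ..
  qed
qed

lemma finite_bases: "finite (bases AR)"
  by (rule finite_subset[of _ "Pow {..<dim_col AR}"]) (auto simp: bases_def)

text \<open>The defining inequalities of \<open>C\<^sup>S\<close> have real coefficients, but integrality of \<open>A\<close> makes positive multiples of
  them integral.\<close>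

lemma rational_int_cone:
  assumes AR: "AR \<in> carrier_mat m n" and AI: "AI \<in> carrier_mat m q"
    and S: "\<forall>J\<in>bases AR. S J \<subseteq> {..<m}"
  shows "rational_cone_points q (int_cone AR AI S)"
proof -
  let ?T = "basis_tableau AR AI"
  have half: "rational_cone_points q {z \<in> carrier_vec q. 0 \<le> row (?T J) p \<bullet> rvec z}"
    "rational_cone_points q {z \<in> carrier_vec q. row (?T J) p \<bullet> rvec z \<le> 0}"
    if J: "J \<in> bases AR" and p: "p < m" for J p
  proof -
    obtain D :: int and a where D: "0 < D" "a \<in> carrier_vec q"
      "\<And>z. z \<in> carrier_vec q \<Longrightarrow> of_int D * (row (?T J) p \<bullet> rvec z) = of_int (a \<bullet> z)"
      using basis_tableau_row_integral[OF AR AI J p] by blast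
    have sign: "(0 \<le> row (?T J) p \<bullet> rvec z) = (0 \<le> a \<bullet> z)"
      "(row (?T J) p \<bullet> rvec z \<le> 0) = (a \<bullet> z \<le> 0)" if z: "z \<in> carrier_vec q" for z
    proof -
      have "(0 \<le> row (?T J) p \<bullet> rvec z) = (0 \<le> real_of_int (a \<bullet> z))"
        unfolding D(3)[OF z, symmetric] using D(1) by (simp add: zero_le_mult_iff)
      then show "(0 \<le> row (?T J) p \<bullet> rvec z) = (0 \<le> a \<bullet> z)" by simp
      have "(row (?T J) p \<bullet> rvec z \<le> 0) = (real_of_int (a \<bullet> z) \<le> 0)"
        unfolding D(3)[OF z, symmetric] using D(1) by (simp add: mult_le_0_iff)
      then show "(row (?T J) p \<bullet> rvec z \<le> 0) = (a \<bullet> z \<le> 0)" by simp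
    qed
    have "{z \<in> carrier_vec q. 0 \<le> row (?T J) p \<bullet> rvec z} = {z \<in> carrier_vec q. 0 \<le> a \<bullet> z}"
      by (rule Collect_cong, rule conj_cong[OF refl]) (rule sign(1))
    moreover have "{z \<in> carrier_vec q. row (?T J) p \<bullet> rvec z \<le> 0} = {z \<in> carrier_vec q. a \<bullet> z \<le> 0}"
      by (rule Collect_cong, rule conj_cong[OF refl]) (rule sign(2))
    ultimately show "rational_cone_points q {z \<in> carrier_vec q. 0 \<le> row (?T J) p \<bullet> rvec z}"
      "rational_cone_points q {z \<in> carrier_vec q. row (?T J) p \<bullet> rvec z \<le> 0}"
      using rational_cone_points_ge[OF D(2)] rational_cone_points_le[OF D(2)] by simp_all
  qed
  have "rational_cone_points q {z \<in> carrier_vec q. \<forall>J\<in>bases AR. rvec z \<in> basis_cone AR AI J (S J)}"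
  proof (rule rational_cone_points_INT[OF finite_bases])
    fix J assume J: "J \<in> bases AR"
    have SJ: "S J \<subseteq> {..<m}" using S J by blast
    have "rational_cone_points q {z \<in> carrier_vec q. \<forall>p\<in>S J. 0 \<le> row (?T J) p \<bullet> rvec z}"
    proof (rule rational_cone_points_INT)
      show "finite (S J)" using SJ by (rule finite_subset) simp
      show "rational_cone_points q {z \<in> carrier_vec q. 0 \<le> row (?T J) p \<bullet> rvec z}" if "p \<in> S J" for p
        using half(1)[OF J] SJ that by blast
    qed
    moreover have "rational_cone_points q
        {z \<in> carrier_vec q. \<forall>p\<in>{..<m} - S J. row (?T J) p \<bullet> rvec z \<le> 0}"
    proof (rule rational_cone_points_INT)
      show "rational_cone_points q {z \<in> carrier_vec q. row (?T J) p \<bullet> rvec z \<le> 0}"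
        if "p \<in> {..<m} - S J" for p
        using half(2)[OF J] that by blast
    qed simp
    moreover have "{z \<in> carrier_vec q. rvec z \<in> basis_cone AR AI J (S J)} =
        {z \<in> carrier_vec q. \<forall>p\<in>S J. 0 \<le> row (?T J) p \<bullet> rvec z} \<inter>
        {z \<in> carrier_vec q. \<forall>p\<in>{..<m} - S J. row (?T J) p \<bullet> rvec z \<le> 0}"
      using AR AI by (auto simp: basis_cone_def)
    ultimately show "rational_cone_points q {z \<in> carrier_vec q. rvec z \<in> basis_cone AR AI J (S J)}"
      using rational_cone_points_Int by simp
  qed
  then show ?thesis using AI by (simp add: int_cone_def)
qed

text \<open>The lists \<open>S\<close> are functions on all sets of natural numbers and hence infinitely many, but a cone depends
  only on the values of \<open>S\<close> on the finitely many bases.\<close>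

lemma finite_graver_star:
  assumes AR: "AR \<in> carrier_mat m n" and AI: "AI \<in> carrier_mat m q"
  shows "finite (graver_star AR AI)"
proof -
  let ?L = "{S. \<forall>J\<in>bases AR. S J \<subseteq> {..<dim_row AR}}"
  let ?G = "\<lambda>S. conic_graver (dim_col AI) (int_cone AR AI S)"
  have "int_cone AR AI S = int_cone AR AI (restrict S (bases AR))" for S
    by (simp add: int_cone_def)
  then have restrict: "?G S = ?G (restrict S (bases AR))" for S by simp
  have "?G ` ?L \<subseteq> ?G ` (bases AR \<rightarrow>\<^sub>E Pow {..<m})"
  proof (rule image_subsetI)
    fix S assume "S \<in> ?L"
    then have "restrict S (bases AR) \<in> bases AR \<rightarrow>\<^sub>E Pow {..<m}" using AR by auto
    then show "?G S \<in> ?G ` (bases AR \<rightarrow>\<^sub>E Pow {..<m})"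
      unfolding restrict[of S] by (rule imageI)
  qed
  then have "finite (?G ` ?L)"
    by (rule finite_subset) (simp add: finite_PiE finite_bases)
  moreover have "finite (?G S)" if "S \<in> ?L" for S
  proof -
    have "rational_cone_points q (int_cone AR AI S)"
      using rational_int_cone[OF AR AI] that AR by simp
    then show ?thesis
      using hilbert_basis_orthant(1) AI by (auto simp: conic_graver_def)
  qed
  ultimately show ?thesis
    unfolding graver_star_def by (metis (no_types, lifting) finite_Union imageE)
qed

section \<open>Basic-integer directions\<close>


lemma basic_direction_eq_embed:
  assumes AR: "AR \<in> carrier_mat m n"
  shows "basic_direction AR AI J g = embed_vec n J (- (basis_tableau AR AI J *\<^sub>v rvec g)) @\<^sub>v rvec g"
  using AR by (simp add: basic_direction_def embed_vec_def)

lemma append_cols_mult_vec: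
  assumes AR: "AR \<in> carrier_mat m n" and AI: "AI \<in> carrier_mat m q"
    and u: "u \<in> carrier_vec n" and w: "w \<in> carrier_vec q"
  shows "rmat (append_cols AR AI) *\<^sub>v (u @\<^sub>v w) = rmat AR *\<^sub>v u + rmat AI *\<^sub>v w"
proof -
  have "rmat (append_cols AR AI) = four_block_mat (rmat AR) (rmat AI) (0\<^sub>m 0 n) (0\<^sub>m 0 q)"
    using AR AI by (auto simp: append_cols_def intro!: eq_matI)
  then have "rmat (append_cols AR AI) *\<^sub>v (u @\<^sub>v w) =
      (rmat AR *\<^sub>v u + rmat AI *\<^sub>v w) @\<^sub>v (0\<^sub>m 0 n *\<^sub>v u + 0\<^sub>m 0 q *\<^sub>v w)"
    using AR AI u w four_block_mat_mult_vec[of "rmat AR" m n "rmat AI" q "0\<^sub>m 0 n" 0 "0\<^sub>m 0 q" u w]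
    by simp
  then show ?thesis by (auto intro!: eq_vecI)
qed

lemma append_cols_carrier:
  assumes "AR \<in> carrier_mat m n" "AI \<in> carrier_mat m q"
  shows "append_cols AR AI \<in> carrier_mat m (n + q)"
  using assms unfolding append_cols_def by (auto intro!: carrier_matI)

lemma mult_mat_vec_uminus:
  fixes A :: "real mat"
  assumes "A \<in> carrier_mat m n" "v \<in> carrier_vec n"
  shows "A *\<^sub>v (- v) = - (A *\<^sub>v v)"
  using assms by (intro eq_vecI) auto

text \<open>Among the vectors supported on a basis exactly one completes the integer part \<open>g\<close> to a kernel vector of
  \<open>A\<close>. One direction shows that basic-integer directions lie in the kernel, the other identifies a
  real part whose support lies in a basis.\<close>

lemma basic_direction_unique:
  assumes AR: "AR \<in> carrier_mat m n" and AI: "AI \<in> carrier_mat m q"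
    and J: "J \<in> bases AR" and g: "g \<in> carrier_vec q"
    and u: "u \<in> carrier_vec n" "vec_supp u \<subseteq> J"
  shows "rmat AR *\<^sub>v u + rmat AI *\<^sub>v rvec g = 0\<^sub>v m \<longleftrightarrow> basic_direction AR AI J g = u @\<^sub>v rvec g"
proof -
  let ?B = "basis_mat AR J" and ?T = "basis_tableau AR AI J"
  obtain C where C: "mat_inverse ?B = Some C" "C \<in> carrier_mat m m" "?B * C = 1\<^sub>m m" "C * ?B = 1\<^sub>m m"
    using basis_mat_inverse[OF AR J] by metis
  note Jn = basis_mat_carrier(1,2)[OF AR J]
  note B = basis_mat_carrier(3)[OF AR J]
  have rAR: "rmat AR \<in> carrier_mat m n" using AR by simp
  define h where "h = rmat AI *\<^sub>v rvec g"
  have h: "h \<in> carrier_vec m" unfolding h_def using AI g by auto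
  have Tg: "?T *\<^sub>v rvec g = C *\<^sub>v h"
    using C(1,2) AI g assoc_mult_mat_vec[OF C(2), of "rmat AI" q "rvec g"]
    by (simp add: basis_tableau_def h_def)
  define y where "y = vec m (\<lambda>k. u $ pick J k)"
  have y: "y \<in> carrier_vec m" by (simp add: y_def)
  have Au: "rmat AR *\<^sub>v u = ?B *\<^sub>v y"
    using mult_mat_vec_submatrix[OF rAR Jn(1) u] Jn(2) by (simp add: basis_mat_def y_def)
  have uy: "u = embed_vec n J y"
    using embed_pick_vec[OF Jn(1) u] Jn(2) by (simp add: y_def)
  have cancel: "C *\<^sub>v (?B *\<^sub>v y) = y" "?B *\<^sub>v (C *\<^sub>v h) = h"
    using assoc_mult_mat_vec[OF C(2) B y] assoc_mult_mat_vec[OF B C(2) h] C(3,4) y h by simp_all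
  show ?thesis
  proof
    assume "rmat AR *\<^sub>v u + rmat AI *\<^sub>v rvec g = 0\<^sub>v m"
    then have sum0: "?B *\<^sub>v y + h = 0\<^sub>v m" using Au by (simp add: h_def)
    have "?B *\<^sub>v y = - h"
    proof (rule eq_vecI)
      fix i assume "i < dim_vec (- h)"
      then have i: "i < m" using h by simp
      have "(?B *\<^sub>v y + h) $ i = 0" using sum0 i by simp
      then show "(?B *\<^sub>v y) $ i = (- h) $ i" using i h B by simp
    qed (use B h in auto)
    then have "y = - (C *\<^sub>v h)"
      using cancel(1) mult_mat_vec_uminus[OF C(2) h] by simp
    then show "basic_direction AR AI J g = u @\<^sub>v rvec g"
      using uy Tg by (simp add: basic_direction_eq_embed[OF AR])
  next
    assume dir: "basic_direction AR AI J g = u @\<^sub>v rvec g"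
    have Ch: "- (C *\<^sub>v h) \<in> carrier_vec (card J)" using C(2) h Jn(2) by simp
    have "embed_vec n J (- (C *\<^sub>v h)) @\<^sub>v rvec g = u @\<^sub>v rvec g"
      using dir Tg by (simp add: basic_direction_eq_embed[OF AR])
    then have "u = embed_vec n J (- (C *\<^sub>v h))"
      using append_vec_eq[OF embed_vec_carrier u(1)] by simp
    then have "y = - (C *\<^sub>v h)"
      using pick_embed_vec[OF Jn(1) Ch] Jn(2) by (simp add: y_def)
    then have "?B *\<^sub>v y = - h"
      using cancel(2) mult_mat_vec_uminus[OF B, of "C *\<^sub>v h"] C(2) h by simp
    then have "?B *\<^sub>v y + h = 0\<^sub>v m" using h by simp
    then show "rmat AR *\<^sub>v u + rmat AI *\<^sub>v rvec g = 0\<^sub>v m"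
      using Au by (simp add: h_def)
  qed
qed

lemma basic_direction_real_index:
  assumes AR: "AR \<in> carrier_mat m n" and AI: "AI \<in> carrier_mat m q" and J: "J \<in> bases AR"
    and j: "j < n"
  shows "basic_direction AR AI J g $ j =
    (if j \<in> J then - (row (basis_tableau AR AI J) (card {i\<in>J. i < j}) \<bullet> rvec g) else 0)"
proof -
  have "card {i\<in>J. i < j} < m" if "j \<in> J"
  proof -
    have "finite J" using basis_mat_carrier(1)[OF AR J] finite_subset by blast
    then have "card {i\<in>J. i < j} < card J" using that by (intro psubset_card_mono) auto
    then show ?thesis using basis_mat_carrier(2)[OF AR J] by simp
  qed
  then show ?thesis
    using AR basis_tableau_carrier[OF AR AI J] j by (simp add: basic_direction_def)
qed

lemma basic_direction_int_index:
  assumes AR: "AR \<in> carrier_mat m n" and g: "g \<in> carrier_vec q" and j: "j < q"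
  shows "basic_direction AR AI J g $ (n + j) = of_int (g $ j)"
  using assms by (simp add: basic_direction_def)

lemma scalar_prod_int_comb:
  assumes F: "finite F" "F \<subseteq> carrier_vec d" and r: "r \<in> carrier_vec d"
  shows "r \<bullet> rvec (finsum_vec TYPE(int) d (\<lambda>h. int (a h) \<cdot>\<^sub>v h) F) = (\<Sum>h\<in>F. real (a h) * (r \<bullet> rvec h))"
proof -
  let ?z = "finsum_vec TYPE(int) d (\<lambda>h. int (a h) \<cdot>\<^sub>v h) F"
  have z: "?z \<in> carrier_vec d" using int_comb_closed[OF F(2)] .
  have "r \<bullet> rvec ?z = (\<Sum>i\<in>{0..<d}. r $ i * of_int (?z $ i))"
    using z by (simp add: scalar_prod_def)
  also have "\<dots> = (\<Sum>i\<in>{0..<d}. \<Sum>h\<in>F. real (a h) * (r $ i * of_int (h $ i)))"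
    by (intro sum.cong) (simp_all add: int_comb_index[OF F] sum_distrib_left mult.left_commute)
  also have "\<dots> = (\<Sum>h\<in>F. \<Sum>i\<in>{0..<d}. real (a h) * (r $ i * of_int (h $ i)))"
    by (rule sum.swap)
  also have "\<dots> = (\<Sum>h\<in>F. real (a h) * (r \<bullet> rvec h))"
  proof (rule sum.cong)
    fix h assume "h \<in> F"
    then have "h \<in> carrier_vec d" using F by auto
    then show "(\<Sum>i\<in>{0..<d}. real (a h) * (r $ i * of_int (h $ i))) = real (a h) * (r \<bullet> rvec h)"
      by (simp add: scalar_prod_def sum_distrib_left)
  qed simp
  finally show ?thesis .
qed

text \<open>The basic-integer direction is linear in its integer part, so that a decomposition of the integer part
  carries over to the whole direction.\<close>

lemma basic_direction_int_comb:
  assumes AR: "AR \<in> carrier_mat m n" and AI: "AI \<in> carrier_mat m q" and J: "J \<in> bases AR"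
    and F: "finite F" "F \<subseteq> carrier_vec q" and i: "i < n + q"
  shows "basic_direction AR AI J (finsum_vec TYPE(int) q (\<lambda>h. int (a h) \<cdot>\<^sub>v h) F) $ i =
    (\<Sum>h\<in>F. real (a h) * basic_direction AR AI J h $ i)"
proof (cases "i < n")
  case True
  note T = basis_tableau_carrier[OF AR AI J]
  have "row (basis_tableau AR AI J) p \<in> carrier_vec q" for p using T by auto
  then show ?thesis
    unfolding basic_direction_real_index[OF AR AI J True]
    by (simp add: scalar_prod_int_comb[OF F] sum_negf)
next
  case False
  then obtain j where j: "i = n + j" "j < q" using i by (metis add_diff_inverse_nat nat_add_left_cancel_less)
  have hc: "h \<in> carrier_vec q" if "h \<in> F" for h using F that by auto
  show ?thesis
    unfolding j(1) using int_comb_closed[OF F(2), of a] j(2)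
    by (simp add: basic_direction_int_index[OF AR _ j(2)] int_comb_index[OF F] hc)
qed


section \<open>Conformal decompositions\<close>

text \<open>The usual conformal relation: \<open>v\<close> lies in the smallest face of an orthant that contains \<open>u\<close>.\<close>

definition conformal :: "real vec \<Rightarrow> real vec \<Rightarrow> bool" where
  "conformal v u \<longleftrightarrow> (\<forall>i<dim_vec u. (0 \<le> u $ i \<longrightarrow> 0 \<le> v $ i) \<and> (u $ i \<le> 0 \<longrightarrow> v $ i \<le> 0))"

lemma conformalD:
  assumes "conformal v u" "u \<in> carrier_vec n" "i < n"
  shows "0 \<le> u $ i \<Longrightarrow> 0 \<le> v $ i" and "u $ i \<le> 0 \<Longrightarrow> v $ i \<le> 0"
  using assms by (auto simp: conformal_def)

lemma conformalI:
  assumes "u \<in> carrier_vec n"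
    and "\<And>i. i < n \<Longrightarrow> 0 \<le> u $ i \<Longrightarrow> 0 \<le> v $ i"
    and "\<And>i. i < n \<Longrightarrow> u $ i \<le> 0 \<Longrightarrow> v $ i \<le> 0"
  shows "conformal v u"
  using assms by (auto simp: conformal_def)

lemma conformal_trans:
  assumes "conformal w v" "conformal v u" "u \<in> carrier_vec n" "v \<in> carrier_vec n"
  shows "conformal w u"
  using assms by (auto simp: conformal_def)

text \<open>Move from \<open>u\<close> along \<open>s\<close> until the first coordinate vanishes. Only coordinates where \<open>s\<close> and \<open>u\<close> have
  opposite signs can vanish, and the ratio test picks the first of them.\<close>

lemma conformal_step:
  assumes u: "u \<in> carrier_vec n" and s: "s \<in> carrier_vec n" "vec_supp s \<subseteq> vec_supp u"
    and blocked: "k < n" "s $ k * u $ k < 0"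
  obtains \<theta> where "0 < \<theta>" "conformal (u + \<theta> \<cdot>\<^sub>v s) u" "vec_supp (u + \<theta> \<cdot>\<^sub>v s) \<subset> vec_supp u"
proof -
  define I where "I = {i. i < n \<and> s $ i * u $ i < 0}"
  have I: "finite I" "I \<noteq> {}" using blocked by (auto simp: I_def)
  \<comment> \<open>the time at which the first blocked coordinate reaches zero\<close>
  define \<theta> where "\<theta> = Min ((\<lambda>i. - u $ i / s $ i) ` I)"
  have "\<theta> \<in> (\<lambda>i. - u $ i / s $ i) ` I" unfolding \<theta>_def using I by (intro Min_in) auto
  then obtain p where p: "p \<in> I" "\<theta> = - u $ p / s $ p" by blast
  have \<theta>_le: "\<theta> \<le> - u $ i / s $ i" if "i \<in> I" for i
    unfolding \<theta>_def using I that by (intro Min_le) auto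
  have pn: "p < n" and ps: "s $ p * u $ p < 0" using p(1) by (auto simp: I_def)
  have \<theta>: "0 < \<theta>"
    using ps unfolding p(2) by (auto simp: mult_less_0_iff divide_neg_pos divide_pos_neg divide_neg_neg)
  let ?v = "u + \<theta> \<cdot>\<^sub>v s"
  have idx: "?v $ i = u $ i + \<theta> * s $ i" if "i < n" for i using that u s by simp
  have supp0: "s $ i = 0" if "i < n" "u $ i = 0" for i
    using that s u by (auto simp: vec_supp_def)
  have "conformal ?v u"
  proof (rule conformalI[OF u])
    fix i assume i: "i < n"
    show "0 \<le> ?v $ i" if ui: "0 \<le> u $ i"
    proof (cases "s $ i < 0")
      case True
      then have "u $ i \<noteq> 0" using supp0[OF i] by auto
      then have "i \<in> I" using i ui True by (simp add: I_def mult_neg_pos)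
      from \<theta>_le[OF this] have "0 \<le> u $ i + \<theta> * s $ i" using True by (simp add: field_simps)
      then show ?thesis using idx[OF i] by simp
    next
      case False
      then show ?thesis using idx[OF i] ui \<theta> by simp
    qed
    show "?v $ i \<le> 0" if ui: "u $ i \<le> 0"
    proof (cases "0 < s $ i")
      case True
      then have "u $ i \<noteq> 0" using supp0[OF i] by auto
      then have "i \<in> I" using i ui True by (simp add: I_def mult_pos_neg)
      from \<theta>_le[OF this] have "u $ i + \<theta> * s $ i \<le> 0" using True by (simp add: field_simps)
      then show ?thesis using idx[OF i] by simp
    next
      case False
      then have "\<theta> * s $ i \<le> 0" using \<theta> by (simp add: mult_le_0_iff)
      then show ?thesis using idx[OF i] ui by simp
    qed
  qed
  moreover have "vec_supp ?v \<subseteq> vec_supp u"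
    using supp0 u s by (auto simp: vec_supp_def)
  moreover have "p \<in> vec_supp u" "p \<notin> vec_supp ?v"
  proof -
    have "s $ p \<noteq> 0" "u $ p \<noteq> 0" using ps by auto
    then show "p \<in> vec_supp u" "p \<notin> vec_supp ?v"
      using pn u idx[OF pn] p(2) by (auto simp: vec_supp_def)
  qed
  ultimately show ?thesis using that \<theta> by blast
qed

text \<open>A point of the polyhedron \<open>{v. A v = d}\<close> in the orthant of \<open>u\<close> is a convex combination of basic
  solutions plus a ray, here in the form of an induction principle. If the columns in the support of
  \<open>u\<close> are dependent, walk from \<open>u\<close> along a kernel vector in both directions. If both walks hit a
  coordinate hyperplane, \<open>u\<close> lies between two points of smaller support; if only one does, the
  other direction is a ray. All points stay in the closed orthant of \<open>u\<close>.\<close>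

lemma conformal_decomposition_induct:
  fixes A :: "real mat"
  assumes A: "A \<in> carrier_mat m n"
    and base: "\<And>u. u \<in> carrier_vec n \<Longrightarrow> A *\<^sub>v u = d \<Longrightarrow> indep_cols A (vec_supp u) \<Longrightarrow> P u"
    and convex: "\<And>u v w l. u \<in> carrier_vec n \<Longrightarrow> v \<in> carrier_vec n \<Longrightarrow> w \<in> carrier_vec n \<Longrightarrow>
      conformal v u \<Longrightarrow> conformal w u \<Longrightarrow> 0 \<le> l \<Longrightarrow> l \<le> 1 \<Longrightarrow>
      u = l \<cdot>\<^sub>v v + (1 - l) \<cdot>\<^sub>v w \<Longrightarrow> P v \<Longrightarrow> P w \<Longrightarrow> P u"
    and ray: "\<And>u v r. u \<in> carrier_vec n \<Longrightarrow> v \<in> carrier_vec n \<Longrightarrow> r \<in> carrier_vec n \<Longrightarrow>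
      conformal v u \<Longrightarrow> conformal r u \<Longrightarrow> A *\<^sub>v r = 0\<^sub>v m \<Longrightarrow> u = v + r \<Longrightarrow> P v \<Longrightarrow> P u"
    and u: "u \<in> carrier_vec n" "A *\<^sub>v u = d"
  shows "P u"
  using u
proof (induction "card (vec_supp u)" arbitrary: u rule: less_induct)
  case less
  note u = less.prems(1) and Au = less.prems(2)
  show ?case
  proof (cases "indep_cols A (vec_supp u)")
    case True
    then show ?thesis using base u Au by blast
  next
    case False
    moreover have "vec_supp u \<subseteq> {..<n}" using u by (auto simp: vec_supp_def)
    ultimately obtain s0 where s0: "s0 \<in> carrier_vec n" "vec_supp s0 \<subseteq> vec_supp u"
        "A *\<^sub>v s0 = 0\<^sub>v m" "s0 \<noteq> 0\<^sub>v n"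
      using A by (auto simp: indep_cols_def)
    obtain k where k: "k < n" "s0 $ k \<noteq> 0"
      using s0 by (metis carrier_vecD eq_vecI index_zero_vec)
    have uk: "u $ k \<noteq> 0" using s0(2) k s0(1) by (auto simp: vec_supp_def)
    \<comment> \<open>the sign makes coordinate \<open>k\<close> shrink along \<open>s\<close>, so the walk along \<open>s\<close> stops\<close>
    define e where "e = (if s0 $ k * u $ k < 0 then 1 else - 1 :: real)"
    define s where "s = e \<cdot>\<^sub>v s0"
    have s: "s \<in> carrier_vec n" "vec_supp s \<subseteq> vec_supp u"
      using s0 by (auto simp: s_def vec_supp_def)
    have As: "A *\<^sub>v s = 0\<^sub>v m"
      unfolding s_def mult_mat_vec_smult[OF A s0(1)] s0(3) by (simp add: vec_eq_iff)
    have sk: "s $ k * u $ k < 0"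
    proof -
      have "s0 $ k * u $ k \<noteq> 0" using k uk by simp
      then have "s0 $ k * u $ k < 0 \<or> 0 < s0 $ k * u $ k" by linarith
      then show ?thesis using k(1) s0(1) by (auto simp: s_def e_def)
    qed
    have move: "P (u + t \<cdot>\<^sub>v s)" if "vec_supp (u + t \<cdot>\<^sub>v s) \<subset> vec_supp u" for t
    proof (rule less.hyps)
      show "card (vec_supp (u + t \<cdot>\<^sub>v s)) < card (vec_supp u)"
        using that finite_vec_supp by (intro psubset_card_mono)
      show "u + t \<cdot>\<^sub>v s \<in> carrier_vec n" using u s by simp
      have "A *\<^sub>v (u + t \<cdot>\<^sub>v s) = A *\<^sub>v u + t \<cdot>\<^sub>v (A *\<^sub>v s)"
        using mult_add_distrib_mat_vec[OF A u, of "t \<cdot>\<^sub>v s"] mult_mat_vec_smult[OF A s(1)] s(1) by simp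
      moreover have "t \<cdot>\<^sub>v (0\<^sub>v m) = (0\<^sub>v m :: real vec)" by (simp add: vec_eq_iff)
      moreover have "d \<in> carrier_vec m" using mult_mat_vec_carrier[OF A u] Au by simp
      ultimately show "A *\<^sub>v (u + t \<cdot>\<^sub>v s) = d" using As Au by simp
    qed
    obtain a where a: "0 < a" "conformal (u + a \<cdot>\<^sub>v s) u" "vec_supp (u + a \<cdot>\<^sub>v s) \<subset> vec_supp u"
      using conformal_step[OF u s k(1) sk] .
    show ?thesis
    proof (cases "\<exists>j<n. - s $ j * u $ j < 0")
      case True
      then obtain j where j: "j < n" "(- s) $ j * u $ j < 0" using s by auto
      have ms: "- s \<in> carrier_vec n" "vec_supp (- s) \<subseteq> vec_supp u"
        using s by (auto simp: vec_supp_def)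
      obtain b where b: "0 < b" "conformal (u + b \<cdot>\<^sub>v (- s)) u" "vec_supp (u + b \<cdot>\<^sub>v (- s)) \<subset> vec_supp u"
        using conformal_step[OF u ms j] .
      have neg: "b \<cdot>\<^sub>v (- s) = (- b) \<cdot>\<^sub>v s" by (simp add: vec_eq_iff)
      \<comment> \<open>the weights that balance the displacements \<open>a s\<close> and \<open>- b s\<close>\<close>
      define l where "l = b / (a + b)"
      have l: "0 \<le> l" "l \<le> 1" "l * a = (1 - l) * b"
        using a(1) b(1) by (simp_all add: l_def field_simps)
      have "u = l \<cdot>\<^sub>v (u + a \<cdot>\<^sub>v s) + (1 - l) \<cdot>\<^sub>v (u + (- b) \<cdot>\<^sub>v s)"
      proof (rule eq_vecI)
        fix i assume "i < dim_vec (l \<cdot>\<^sub>v (u + a \<cdot>\<^sub>v s) + (1 - l) \<cdot>\<^sub>v (u + (- b) \<cdot>\<^sub>v s))"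
        then have i: "i < n" using u s by simp
        have "l * (u $ i + a * s $ i) + (1 - l) * (u $ i + - b * s $ i) =
            u $ i + (l * a - (1 - l) * b) * s $ i" by (simp add: algebra_simps)
        then show "u $ i = (l \<cdot>\<^sub>v (u + a \<cdot>\<^sub>v s) + (1 - l) \<cdot>\<^sub>v (u + (- b) \<cdot>\<^sub>v s)) $ i"
          using i u s l(3) by simp
      qed (use u s in simp)
      then show ?thesis
        using convex[OF u _ _ a(2) b(2)[unfolded neg] l(1,2)] move[OF a(3)] move[OF b(3)[unfolded neg]] u s
        by simp
    next
      case False
      define r where "r = (- a) \<cdot>\<^sub>v s"
      have r: "r \<in> carrier_vec n" using s by (simp add: r_def)
      have "conformal r u"
      proof (rule conformalI[OF u])
        fix i assume i: "i < n"
        have "\<not> - s $ i * u $ i < 0" using False i by blast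
        then have nb: "s $ i * u $ i \<le> 0" by simp
        have z: "s $ i = 0" if "u $ i = 0" using s u i that by (auto simp: vec_supp_def)
        show "0 \<le> r $ i" if "0 \<le> u $ i"
        proof -
          have "s $ i \<le> 0" using nb that z by (cases "u $ i = 0") (auto simp: mult_le_0_iff)
          then show ?thesis using i s a(1) by (simp add: r_def mult_nonneg_nonpos)
        qed
        show "r $ i \<le> 0" if "u $ i \<le> 0"
        proof -
          have "0 \<le> s $ i" using nb that z by (cases "u $ i = 0") (auto simp: mult_le_0_iff)
          then show ?thesis using i s a(1) by (simp add: r_def)
        qed
      qed
      moreover have "A *\<^sub>v r = 0\<^sub>v m"
        unfolding r_def mult_mat_vec_smult[OF A s(1)] As by (simp add: vec_eq_iff)
      moreover have "u = (u + a \<cdot>\<^sub>v s) + r"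
        using u s by (auto simp: r_def vec_eq_iff)
      ultimately show ?thesis
        using ray[OF u _ r a(2)] move[OF a(3)] u s by simp
    qed
  qed
qed

text \<open>If all summands of a step have the same sign in a coordinate, one summand on its own overshoots no
  more than the whole step. The coefficients have to be at least one for this.\<close>

lemma sign_consistent_summands:
  fixes t :: "'b \<Rightarrow> real"
  assumes F: "finite F" "\<And>h. h \<in> F \<Longrightarrow> 1 \<le> a h"
    and sign: "((\<forall>h\<in>F. 0 \<le> t h) \<and> 0 \<le> r) \<or> ((\<forall>h\<in>F. t h \<le> 0) \<and> r \<le> 0)"
    and x: "0 \<le> x" "0 \<le> x + ((\<Sum>h\<in>F. real (a h) * t h) + r)"
  shows "(\<forall>h\<in>F. 0 \<le> x + t h) \<and> 0 \<le> x + r"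
  using sign
proof
  assume "(\<forall>h\<in>F. 0 \<le> t h) \<and> 0 \<le> r"
  then show ?thesis using x by auto
next
  assume neg: "(\<forall>h\<in>F. t h \<le> 0) \<and> r \<le> 0"
  have "(\<Sum>h\<in>F. real (a h) * t h) \<le> t h" if h: "h \<in> F" for h
  proof -
    have "(\<Sum>h\<in>F. real (a h) * t h) = real (a h) * t h + (\<Sum>k\<in>F - {h}. real (a k) * t k)"
      by (rule sum.remove[OF F(1) h])
    also have "(\<Sum>k\<in>F - {h}. real (a k) * t k) \<le> 0"
      using neg by (intro sum_nonpos) (auto simp: mult_nonneg_nonpos)
    finally have "(\<Sum>h\<in>F. real (a h) * t h) \<le> real (a h) * t h" by simp
    also have "\<dots> \<le> 1 * t h"
      using neg h F(2)[OF h] by (intro mult_right_mono_neg) auto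
    finally show ?thesis by simp
  qed
  moreover have "(\<Sum>h\<in>F. real (a h) * t h) \<le> 0"
    using neg by (intro sum_nonpos) (auto simp: mult_nonneg_nonpos)
  ultimately show ?thesis using x(2) neg by force
qed

text \<open>The sign of the sum is the sign of each summand; if the sum is zero, so are all summands, because
  no coefficient vanishes.\<close>

lemma sign_consistent_sum:
  fixes t :: "'b \<Rightarrow> real"
  assumes F: "finite F" "\<And>h. h \<in> F \<Longrightarrow> 1 \<le> a h"
    and sign: "(\<forall>h\<in>F. 0 \<le> t h) \<or> (\<forall>h\<in>F. t h \<le> 0)" and h: "h \<in> F"
  shows "0 \<le> (\<Sum>h\<in>F. real (a h) * t h) \<Longrightarrow> 0 \<le> t h"
    and "(\<Sum>h\<in>F. real (a h) * t h) \<le> 0 \<Longrightarrow> t h \<le> 0"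
proof -
  let ?s = "\<Sum>h\<in>F. real (a h) * t h"
  show "0 \<le> t h" if "0 \<le> ?s"
    using sign
  proof
    assume "\<forall>h\<in>F. t h \<le> 0"
    then show ?thesis
      using sign_consistent_summands[where F = F and a = a and t = t and r = 0 and x = 0, OF F] that h by auto
  qed (use h in auto)
  show "t h \<le> 0" if "?s \<le> 0"
    using sign
  proof
    assume "\<forall>h\<in>F. 0 \<le> t h"
    then have "0 \<le> 0 + - t h"
      using sign_consistent_summands[where F = F and a = a and t = "\<lambda>h. - t h" and r = 0 and x = 0, OF F] that h by (auto simp: sum_negf)
    then show ?thesis by simp
  qed (use h in auto)
qed

section \<open>Improving a feasible point\<close>

lemma mixed_vecs_split:
  assumes "x \<in> mixed_vecs n q"
  obtains xR xI where "xR \<in> carrier_vec n" "xI \<in> carrier_vec q" "x = xR @\<^sub>v rvec xI"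
proof -
  have x: "x \<in> carrier_vec (n + q)" using assms by (simp add: mixed_vecs_def)
  define xI where "xI = vec q (\<lambda>j. \<lfloor>x $ (n + j)\<rfloor>)"
  have "x $ (n + j) = of_int (xI $ j)" if "j < q" for j
  proof -
    have "x $ (n + j) \<in> \<int>" using assms that by (simp add: mixed_vecs_def)
    then show ?thesis using that by (simp add: xI_def)
  qed
  then have "x = vec n (\<lambda>i. x $ i) @\<^sub>v rvec xI"
    using x by (auto intro!: eq_vecI simp: xI_def)
  then show ?thesis using that[of "vec n (\<lambda>i. x $ i)" xI] by (simp add: xI_def)
qed

lemma mixed_vecs_append:
  assumes "u \<in> carrier_vec n" "h \<in> carrier_vec q"
  shows "u @\<^sub>v rvec h \<in> mixed_vecs n q"
  using assms by (auto simp: mixed_vecs_def)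

lemma mixed_vecs_add:
  assumes "x \<in> mixed_vecs n q" "y \<in> mixed_vecs n q"
  shows "x + y \<in> mixed_vecs n q"
  using assms by (auto simp: mixed_vecs_def)

lemma basis_exists:
  assumes AR: "AR \<in> carrier_mat m n" and rank: "vec_space.rank m (rmat AR) = m"
  obtains J where "J \<in> bases AR"
proof -
  have "indep_cols (rmat AR) {}"
    by (auto simp: indep_cols_def vec_supp_eq_empty_iff)
  then show ?thesis using indep_cols_subset_basis[OF AR rank] that by metis
qed

text \<open>A basic-integer direction with integer part \<open>h\<close>, for any basis whatsoever, differs from \<open>(u, h)\<close> by
  a kernel vector of the real part of the matrix, and circuits generate this kernel. For \<open>h = 0\<close> the zero
  vector replaces the direction.\<close>

lemma kernel_step_eq_test_direction_plus_circuits: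
  assumes AR: "AR \<in> carrier_mat m n" and AI: "AI \<in> carrier_mat m q"
    and rank: "vec_space.rank m (rmat AR) = m"
    and u: "u \<in> carrier_vec n" and h: "h \<in> insert (0\<^sub>v q) (graver_star AR AI)" "h \<in> carrier_vec q"
    and ker: "rmat AR *\<^sub>v u + rmat AI *\<^sub>v rvec h = 0\<^sub>v m"
  shows "\<exists>t\<^sub>0\<in>T_star AR AI \<union> {0\<^sub>v (n + q)}. \<exists>(l::nat) s \<beta>.
    (\<forall>i<l. s i \<in> padded_circuits AR q \<and> 0 \<le> \<beta> i) \<and>
    t\<^sub>0 \<in> carrier_vec (n + q) \<and> finsum_vec TYPE(real) (n + q) (\<lambda>i. \<beta> i \<cdot>\<^sub>v s i) {..<l} \<in> carrier_vec (n + q) \<and>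
    t\<^sub>0 + finsum_vec TYPE(real) (n + q) (\<lambda>i. \<beta> i \<cdot>\<^sub>v s i) {..<l} = u @\<^sub>v rvec h"
proof -
  obtain J where J: "J \<in> bases AR" using basis_exists[OF AR rank] .
  have "\<exists>v\<in>carrier_vec n. v @\<^sub>v rvec h \<in> T_star AR AI \<union> {0\<^sub>v (n + q)} \<and>
      rmat AR *\<^sub>v v + rmat AI *\<^sub>v rvec h = 0\<^sub>v m"
  proof (cases "h \<in> graver_star AR AI")
    case True
    let ?v = "embed_vec n J (- (basis_tableau AR AI J *\<^sub>v rvec h))"
    have dir: "basic_direction AR AI J h = ?v @\<^sub>v rvec h" by (rule basic_direction_eq_embed[OF AR])
    have "basic_direction AR AI J h \<in> T_star AR AI"
      using J True by (auto simp: T_star_def basic_directions_def)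
    moreover have "rmat AR *\<^sub>v ?v + rmat AI *\<^sub>v rvec h = 0\<^sub>v m"
      using basic_direction_unique[OF AR AI J h(2) embed_vec_carrier vec_supp_embed_vec] dir by blast
    ultimately show ?thesis using dir embed_vec_carrier by (metis UnI1)
  next
    case False
    then have h0: "h = 0\<^sub>v q" using h by simp
    have "(0\<^sub>v n :: real vec) @\<^sub>v rvec h = 0\<^sub>v (n + q)"
      unfolding h0 by (auto intro!: eq_vecI)
    moreover have "rmat AR *\<^sub>v 0\<^sub>v n + rmat AI *\<^sub>v rvec h = 0\<^sub>v m"
      unfolding h0 rvec_zero using AR AI by (auto intro!: eq_vecI)
    ultimately show ?thesis by (intro bexI[of _ "0\<^sub>v n"]) auto
  qed
  then obtain v where v: "v \<in> carrier_vec n" "v @\<^sub>v rvec h \<in> T_star AR AI \<union> {0\<^sub>v (n + q)}"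
      "rmat AR *\<^sub>v v + rmat AI *\<^sub>v rvec h = 0\<^sub>v m" by blast
  have rAR: "rmat AR \<in> carrier_mat m n" using AR by simp
  have AIh: "rmat AI *\<^sub>v rvec h \<in> carrier_vec m" using AI h(2) by (auto intro: mult_mat_vec_carrier)
  have "rmat AR *\<^sub>v (u - v) = rmat AR *\<^sub>v u - rmat AR *\<^sub>v v"
    using mult_minus_distrib_mat_vec[OF rAR u v(1)] .
  also have "\<dots> = 0\<^sub>v m"
  proof (rule eq_vecI)
    fix i assume "i < dim_vec (0\<^sub>v m)"
    then have i: "i < m" by simp
    have "(rmat AR *\<^sub>v u + rmat AI *\<^sub>v rvec h) $ i = (rmat AR *\<^sub>v v + rmat AI *\<^sub>v rvec h) $ i"
      using ker v(3) by simp
    moreover have "(w + rmat AI *\<^sub>v rvec h) $ i = w $ i + (rmat AI *\<^sub>v rvec h) $ i" for w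
      by (rule index_add_vec(1)) (use AI i in simp)
    ultimately have "(rmat AR *\<^sub>v u) $ i = (rmat AR *\<^sub>v v) $ i" by simp
    then show "(rmat AR *\<^sub>v u - rmat AR *\<^sub>v v) $ i = 0\<^sub>v m $ i"
      using i rAR by (simp del: index_mult_mat_vec)
  qed (use rAR in simp)
  finally have "rmat AR *\<^sub>v (u - v) = 0\<^sub>v m" .
  moreover have uv: "u - v \<in> carrier_vec n" using u v by simp
  ultimately obtain l \<sigma> \<beta> where c: "\<And>i. i < (l::nat) \<Longrightarrow> \<sigma> i \<in> circuits AR \<and> 0 \<le> \<beta> i"
    "\<And>j. j < n \<Longrightarrow> (u - v) $ j = (\<Sum>i<l. \<beta> i * real_of_int (\<sigma> i $ j))"
    using kernel_eq_circuit_combination[OF AR] by metis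
  let ?s = "\<lambda>i. rvec (\<sigma> i) @\<^sub>v 0\<^sub>v q"
  have sc: "\<sigma> i \<in> carrier_vec n" if "i < l" for i
    using c(1)[OF that] AR by (auto simp: circuits_def)
  have fc: "(\<lambda>i. \<beta> i \<cdot>\<^sub>v ?s i) \<in> {..<l} \<rightarrow> carrier_vec (n + q)"
    using sc by (intro Pi_I) (simp add: append_carrier_vec)
  let ?f = "finsum_vec TYPE(real) (n + q) (\<lambda>i. \<beta> i \<cdot>\<^sub>v ?s i) {..<l}"
  have fcar: "?f \<in> carrier_vec (n + q)" using finsum_vec_closed[OF fc] .
  have "(v @\<^sub>v rvec h) + ?f = u @\<^sub>v rvec h"
  proof (rule eq_vecI)
    show "dim_vec ((v @\<^sub>v rvec h) + ?f) = dim_vec (u @\<^sub>v rvec h)"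
      using fcar u h(2) by simp
    fix j assume "j < dim_vec (u @\<^sub>v rvec h)"
    then have j: "j < n + q" using u h(2) by simp
    have "?f $ j = (\<Sum>i<l. (\<beta> i \<cdot>\<^sub>v ?s i) $ j)"
      using index_finsum_vec[OF _ j fc] by simp
    also have "\<dots> = (\<Sum>i<l. if j < n then \<beta> i * real_of_int (\<sigma> i $ j) else 0)"
    proof (rule sum.cong)
      fix i assume "i \<in> {..<l}"
      then have "\<sigma> i \<in> carrier_vec n" using sc by simp
      then show "(\<beta> i \<cdot>\<^sub>v ?s i) $ j = (if j < n then \<beta> i * real_of_int (\<sigma> i $ j) else 0)"
        using j by auto
    qed simp
    also have "\<dots> = (if j < n then (u - v) $ j else 0)"
      using c(2)[of j] by simp
    finally have "?f $ j = (if j < n then (u - v) $ j else 0)" .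
    then show "((v @\<^sub>v rvec h) + ?f) $ j = (u @\<^sub>v rvec h) $ j"
      using j fcar u v(1) h(2) by auto
  qed
  moreover have "\<forall>i<l. ?s i \<in> padded_circuits AR q \<and> 0 \<le> \<beta> i"
    using c(1) by (auto simp: padded_circuits_def)
  moreover have "v @\<^sub>v rvec h \<in> carrier_vec (n + q)"
    using v(1) h(2) by (intro append_carrier_vec) auto
  ultimately show ?thesis
    using v(2) fcar
    by (intro bexI[of _ "v @\<^sub>v rvec h"] exI[of _ l] exI[of _ ?s] exI[of _ \<beta>] conjI)
qed

text \<open>The list \<open>S\<close> and the orthant \<open>K\<close> are read off from the signs of \<open>z\<close>, so that \<open>z\<close> lies in the cone; the
  elements of its Hilbert basis then share the signs of \<open>z\<close>, in every coordinate and in every row of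
  every basis tableau.\<close>

lemma graver_decomposition:
  assumes AR: "AR \<in> carrier_mat m n" and AI: "AI \<in> carrier_mat m q" and z: "z \<in> carrier_vec q"
  obtains a F where "finite F" "F \<subseteq> graver_star AR AI" "F \<subseteq> carrier_vec q"
    "\<And>h. h \<in> F \<Longrightarrow> 1 \<le> a h" "z = finsum_vec TYPE(int) q (\<lambda>h. int (a h) \<cdot>\<^sub>v h) F"
    "\<And>j. j < q \<Longrightarrow> (\<forall>h\<in>F. 0 \<le> h $ j) \<or> (\<forall>h\<in>F. h $ j \<le> 0)"
    "\<And>J p. J \<in> bases AR \<Longrightarrow> p < m \<Longrightarrow>
      (\<forall>h\<in>F. 0 \<le> row (basis_tableau AR AI J) p \<bullet> rvec h) \<or>
      (\<forall>h\<in>F. row (basis_tableau AR AI J) p \<bullet> rvec h \<le> 0)"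
proof -
  let ?T = "basis_tableau AR AI"
  define S where "S J = {p. p < m \<and> 0 \<le> row (?T J) p \<bullet> rvec z}" for J
  define K where "K = {j. j < q \<and> 0 \<le> z $ j}"
  have SL: "\<forall>J\<in>bases AR. S J \<subseteq> {..<m}" by (auto simp: S_def)
  have Kq: "K \<subseteq> {..<q}" by (auto simp: K_def)
  let ?M = "int_cone AR AI S \<inter> orthant q K"
  let ?H = "hilbert_basis q ?M"
  note H = hilbert_basis_orthant[OF rational_int_cone[OF AR AI SL] Kq]
  have "z \<in> int_cone AR AI S"
    using z AR AI by (auto simp: int_cone_def basis_cone_def S_def)
  moreover have "z \<in> orthant q K" using z by (auto simp: orthant_def K_def)
  ultimately have zH: "z \<in> nonneg_int_combs q ?H" using H(3) by blast
  have Hc: "?H \<subseteq> carrier_vec q" using H(2) by (auto simp: orthant_def)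
  obtain a F where F: "finite F" "F \<subseteq> ?H" "\<And>h. h \<in> F \<Longrightarrow> 1 \<le> a h"
    "z = finsum_vec TYPE(int) q (\<lambda>h. int (a h) \<cdot>\<^sub>v h) F"
    using nonneg_int_combs_positive[OF Hc zH] by metis
  have "?H \<subseteq> graver_star AR AI"
    unfolding graver_star_def conic_graver_def
    using SL Kq AR AI by (intro subsetI UN_I[of S] UN_I[of K]) auto
  then have FG: "F \<subseteq> graver_star AR AI" using F(2) by blast
  have FM: "h \<in> int_cone AR AI S" "h \<in> orthant q K" if "h \<in> F" for h
    using that F(2) H(2) by auto
  show ?thesis
  proof (rule that[OF F(1) FG _ F(3,4)])
    show "F \<subseteq> carrier_vec q" using F(2) Hc by blast
    show "(\<forall>h\<in>F. 0 \<le> h $ j) \<or> (\<forall>h\<in>F. h $ j \<le> 0)" if "j < q" for j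
      using FM(2) that by (cases "j \<in> K") (auto simp: orthant_def)
    show "(\<forall>h\<in>F. 0 \<le> row (?T J) p \<bullet> rvec h) \<or> (\<forall>h\<in>F. row (?T J) p \<bullet> rvec h \<le> 0)"
      if J: "J \<in> bases AR" and p: "p < m" for J p
    proof (cases "p \<in> S J")
      case True
      then have "0 \<le> row (?T J) p \<bullet> rvec h" if "h \<in> F" for h
        using FM(1)[OF that] J by (auto simp: int_cone_def basis_cone_def)
      then show ?thesis by blast
    next
      case False
      then have "row (?T J) p \<bullet> rvec h \<le> 0" if "h \<in> F" for h
        using FM(1)[OF that] J p AR by (auto simp: int_cone_def basis_cone_def)
      then show ?thesis by blast
    qed
  qed
qed

text \<open>For a real part supported on a basis, the summands are the real parts of basic-integer directions:
  they add up by linearity and share their signs because the rows of the tableau have constant sign on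
  the summands \<open>h\<close>. The general case follows by the induction principle, since summand families can be
  mixed with the weights of a convex combination, and a ray can be added to \<open>r\<close>.\<close>

lemma real_part_splits_along_summands:
  assumes AR: "AR \<in> carrier_mat m n" and AI: "AI \<in> carrier_mat m q"
    and rank: "vec_space.rank m (rmat AR) = m"
    and F: "finite F" "F \<subseteq> carrier_vec q" "\<And>h. h \<in> F \<Longrightarrow> 1 \<le> a h"
    and z: "z = finsum_vec TYPE(int) q (\<lambda>h. int (a h) \<cdot>\<^sub>v h) F"
    and sign: "\<And>J p. J \<in> bases AR \<Longrightarrow> p < m \<Longrightarrow>
      (\<forall>h\<in>F. 0 \<le> row (basis_tableau AR AI J) p \<bullet> rvec h) \<or>
      (\<forall>h\<in>F. row (basis_tableau AR AI J) p \<bullet> rvec h \<le> 0)"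
    and u: "u \<in> carrier_vec n" "rmat AR *\<^sub>v u = - (rmat AI *\<^sub>v rvec z)"
  shows "\<exists>U r. (\<forall>h\<in>F. U h \<in> carrier_vec n \<and> conformal (U h) u \<and>
        rmat AR *\<^sub>v U h = - (rmat AI *\<^sub>v rvec h)) \<and>
      r \<in> carrier_vec n \<and> conformal r u \<and> rmat AR *\<^sub>v r = 0\<^sub>v m \<and>
      (\<forall>i<n. u $ i = (\<Sum>h\<in>F. real (a h) * U h $ i) + r $ i)"
    (is "?P u")
proof (rule conformal_decomposition_induct[where P = ?P, OF _ _ _ _ u])
  let ?d = "\<lambda>h. - (rmat AI *\<^sub>v rvec h)"
  show rAR: "rmat AR \<in> carrier_mat m n" using AR by simp
  have zc: "z \<in> carrier_vec q" unfolding z using int_comb_closed[OF F(2)] .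
  have hc: "h \<in> carrier_vec q" if "h \<in> F" for h using F(2) that by auto
  have dc: "?d h \<in> carrier_vec m" for h using AI by (auto intro!: carrier_vecI)
  have eq_neg: "rmat AR *\<^sub>v w = ?d h \<longleftrightarrow> rmat AR *\<^sub>v w + rmat AI *\<^sub>v rvec h = 0\<^sub>v m" for w h
    using AR AI by (auto simp: vec_eq_iff eq_neg_iff_add_eq_0 simp del: index_mult_mat_vec)
  show "?P u" if u: "u \<in> carrier_vec n" "rmat AR *\<^sub>v u = ?d z" and
    ind: "indep_cols (rmat AR) (vec_supp u)" for u
  proof -
    obtain J where J: "J \<in> bases AR" "vec_supp u \<subseteq> J"
      using indep_cols_subset_basis[OF AR rank ind] .
    define U where "U h = embed_vec n J (- (basis_tableau AR AI J *\<^sub>v rvec h))" for h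
    have Uc: "U h \<in> carrier_vec n" for h by (simp add: U_def embed_vec_carrier)
    have dir: "basic_direction AR AI J h = U h @\<^sub>v rvec h" for h
      unfolding U_def by (rule basic_direction_eq_embed[OF AR])
    have Udir: "U h $ i = basic_direction AR AI J h $ i" if "i < n" for h i
      using that Uc[of h] by (simp add: dir)
    have "rmat AR *\<^sub>v U h + rmat AI *\<^sub>v rvec h = 0\<^sub>v m" if "h \<in> F" for h
      using basic_direction_unique[OF AR AI J(1) hc[OF that] Uc] dir
      by (simp add: U_def vec_supp_embed_vec)
    then have UA: "rmat AR *\<^sub>v U h = ?d h" if "h \<in> F" for h using that eq_neg by blast
    have zdir: "basic_direction AR AI J z = u @\<^sub>v rvec z"
      using basic_direction_unique[OF AR AI J(1) zc u(1) J(2)] u(2) eq_neg by blast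
    have sum: "u $ i = (\<Sum>h\<in>F. real (a h) * U h $ i)" if i: "i < n" for i
    proof -
      have "u $ i = basic_direction AR AI J z $ i" using i u(1) by (simp add: zdir)
      also have "\<dots> = (\<Sum>h\<in>F. real (a h) * U h $ i)"
        unfolding z Udir[OF i] using basic_direction_int_comb[OF AR AI J(1) F(1,2)] i by simp
      finally show ?thesis .
    qed
    have Usign: "(\<forall>h\<in>F. 0 \<le> U h $ i) \<or> (\<forall>h\<in>F. U h $ i \<le> 0)" if i: "i < n" for i
    proof (cases "i \<in> J")
      case True
      have "finite J" using basis_mat_carrier(1)[OF AR J(1)] finite_subset by blast
      then have "card {k\<in>J. k < i} < card J" using True by (intro psubset_card_mono) auto
      then have "card {k\<in>J. k < i} < m" using basis_mat_carrier(2)[OF AR J(1)] by simp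
      from sign[OF J(1) this] show ?thesis
        unfolding Udir[OF i] basic_direction_real_index[OF AR AI J(1) i] using True by auto
    next
      case False
      then show ?thesis
        unfolding Udir[OF i] basic_direction_real_index[OF AR AI J(1) i] by simp
    qed
    have "conformal (U h) u" if "h \<in> F" for h
      using sign_consistent_sum[where F = F and a = a, OF F(1,3) Usign that] sum
      by (intro conformalI[OF u(1)]) auto
    moreover have "conformal (0\<^sub>v n) u" by (rule conformalI[OF u(1)]) simp_all
    moreover have "rmat AR *\<^sub>v 0\<^sub>v n = 0\<^sub>v m" using AR by (auto intro!: eq_vecI)
    ultimately show ?thesis
      using Uc UA sum by (intro exI[of _ U] exI[of _ "0\<^sub>v n"]) simp
  qed
  show "?P u" if u: "u \<in> carrier_vec n" and vc: "v \<in> carrier_vec n" and wc: "w \<in> carrier_vec n"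
    and cv: "conformal v u" and cw: "conformal w u" and l: "0 \<le> l" "l \<le> 1"
    and comb: "u = l \<cdot>\<^sub>v v + (1 - l) \<cdot>\<^sub>v w" and Pv: "?P v" and Pw: "?P w" for u v w l
  proof -
    obtain V r where V: "\<And>h. h \<in> F \<Longrightarrow> V h \<in> carrier_vec n" "\<And>h. h \<in> F \<Longrightarrow> conformal (V h) v"
      "\<And>h. h \<in> F \<Longrightarrow> rmat AR *\<^sub>v V h = ?d h"
      "r \<in> carrier_vec n" "conformal r v" "rmat AR *\<^sub>v r = 0\<^sub>v m"
      "\<And>i. i < n \<Longrightarrow> v $ i = (\<Sum>h\<in>F. real (a h) * V h $ i) + r $ i"
      using Pv by blast
    obtain W s where W: "\<And>h. h \<in> F \<Longrightarrow> W h \<in> carrier_vec n" "\<And>h. h \<in> F \<Longrightarrow> conformal (W h) w"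
      "\<And>h. h \<in> F \<Longrightarrow> rmat AR *\<^sub>v W h = ?d h"
      "s \<in> carrier_vec n" "conformal s w" "rmat AR *\<^sub>v s = 0\<^sub>v m"
      "\<And>i. i < n \<Longrightarrow> w $ i = (\<Sum>h\<in>F. real (a h) * W h $ i) + s $ i"
      using Pw by blast
    define mix where "mix x y = l \<cdot>\<^sub>v x + (1 - l) \<cdot>\<^sub>v y" for x y :: "real vec"
    have mixc: "mix x y \<in> carrier_vec n" if "x \<in> carrier_vec n" "y \<in> carrier_vec n" for x y
      using that by (simp add: mix_def)
    have mix_idx: "mix x y $ i = l * x $ i + (1 - l) * y $ i"
      if "x \<in> carrier_vec n" "y \<in> carrier_vec n" "i < n" for x y i
      using that by (simp add: mix_def)
    have mixA: "rmat AR *\<^sub>v mix x y = d" if "x \<in> carrier_vec n" "y \<in> carrier_vec n"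
      "rmat AR *\<^sub>v x = d" "rmat AR *\<^sub>v y = d" for x y d
    proof -
      have "rmat AR *\<^sub>v mix x y = l \<cdot>\<^sub>v d + (1 - l) \<cdot>\<^sub>v d"
        unfolding mix_def
        using mult_add_distrib_mat_vec[OF rAR, of "l \<cdot>\<^sub>v x" "(1 - l) \<cdot>\<^sub>v y"] that
          mult_mat_vec_smult[OF rAR that(1)] mult_mat_vec_smult[OF rAR that(2)] by simp
      also have "\<dots> = d" by (auto simp: vec_eq_iff algebra_simps)
      finally show ?thesis .
    qed
    have mixconf: "conformal (mix x y) u" if xy: "x \<in> carrier_vec n" "y \<in> carrier_vec n"
      and "conformal x v" "conformal y w" for x y
    proof (rule conformalI[OF u])
      have cx: "conformal x u" and cy: "conformal y u"
        using that conformal_trans cv cw u vc wc by blast+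
      fix i assume i: "i < n"
      show "0 \<le> mix x y $ i" if "0 \<le> u $ i"
        unfolding mix_idx[OF xy i]
        using conformalD(1)[OF cx u i that] conformalD(1)[OF cy u i that] l by simp
      show "mix x y $ i \<le> 0" if "u $ i \<le> 0"
        unfolding mix_idx[OF xy i]
        using conformalD(2)[OF cx u i that] conformalD(2)[OF cy u i that] l
        by (simp add: add_nonpos_nonpos mult_nonneg_nonpos)
    qed
    have "u $ i = (\<Sum>h\<in>F. real (a h) * mix (V h) (W h) $ i) + mix r s $ i" if i: "i < n" for i
    proof -
      have "u $ i = l * v $ i + (1 - l) * w $ i" using i comb vc wc by simp
      also have "\<dots> = (\<Sum>h\<in>F. l * (real (a h) * V h $ i) + (1 - l) * (real (a h) * W h $ i)) +
          (l * r $ i + (1 - l) * s $ i)"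
        unfolding V(7)[OF i] W(7)[OF i] by (simp add: sum.distrib sum_distrib_left distrib_left)
      also have "\<dots> = (\<Sum>h\<in>F. real (a h) * mix (V h) (W h) $ i) + mix r s $ i"
        unfolding mix_idx[OF V(4) W(4) i]
        by (intro arg_cong2[where f = "(+)"] sum.cong refl)
          (simp add: mix_idx[OF V(1) W(1) i] algebra_simps)
      finally show ?thesis .
    qed
    then show ?thesis
      using mixc mixA mixconf V W
      by (intro exI[of _ "\<lambda>h. mix (V h) (W h)"] exI[of _ "mix r s"]) auto
  qed
  show "?P u" if u: "u \<in> carrier_vec n" and vc: "v \<in> carrier_vec n" and rc: "r \<in> carrier_vec n"
    and cv: "conformal v u" and cr: "conformal r u" and Ar: "rmat AR *\<^sub>v r = 0\<^sub>v m"
    and comb: "u = v + r" and Pv: "?P v" for u v r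
  proof -
    obtain V s where V: "\<And>h. h \<in> F \<Longrightarrow> V h \<in> carrier_vec n" "\<And>h. h \<in> F \<Longrightarrow> conformal (V h) v"
      "\<And>h. h \<in> F \<Longrightarrow> rmat AR *\<^sub>v V h = ?d h"
      "s \<in> carrier_vec n" "conformal s v" "rmat AR *\<^sub>v s = 0\<^sub>v m"
      "\<And>i. i < n \<Longrightarrow> v $ i = (\<Sum>h\<in>F. real (a h) * V h $ i) + s $ i"
      using Pv by blast
    have "conformal (V h) u" if "h \<in> F" for h
      using V(2)[OF that] cv u vc by (rule conformal_trans)
    moreover have "conformal (s + r) u"
    proof (rule conformalI[OF u])
      have cs: "conformal s u" using V(5) cv u vc by (rule conformal_trans)
      fix i assume i: "i < n"
      show "0 \<le> (s + r) $ i" if "0 \<le> u $ i"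
        using conformalD(1)[OF cs u i that] conformalD(1)[OF cr u i that] i rc by simp
      show "(s + r) $ i \<le> 0" if "u $ i \<le> 0"
        using conformalD(2)[OF cs u i that] conformalD(2)[OF cr u i that] i rc by simp
    qed
    moreover have "rmat AR *\<^sub>v (s + r) = 0\<^sub>v m"
      using mult_add_distrib_mat_vec[OF rAR V(4) rc] V(6) Ar by simp
    moreover have "u $ i = (\<Sum>h\<in>F. real (a h) * V h $ i) + (s + r) $ i" if i: "i < n" for i
      using V(7)[OF i] comb i vc rc V(4) by simp
    ultimately show ?thesis
      using V rc by (intro exI[of _ V] exI[of _ "s + r"]) simp
  qed
qed

lemma nonneg_vec_index:
  assumes "0\<^sub>v k \<le> (v :: real vec)" "i < k"
  shows "0 \<le> v $ i"
  using assms unfolding less_eq_vec_def by (metis index_zero_vec)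

text \<open>The step from \<open>x\<close> to the cheaper point \<open>y\<close> is a positive combination of steps \<open>(U h, h)\<close> and \<open>(r, 0)\<close> that
  have its signs. Each of them taken alone keeps \<open>x\<close> nonnegative, and as the costs add up to a negative
  number, one of them has negative cost.\<close>

lemma improving_kernel_step_exists:
  assumes AR: "AR \<in> carrier_mat m n" and AI: "AI \<in> carrier_mat m q"
    and rank: "vec_space.rank m (rmat AR) = m" and c: "c \<in> carrier_vec (n + q)"
    and x: "x \<in> mip_feasible n q (append_cols AR AI) b"
    and y: "y \<in> mip_feasible n q (append_cols AR AI) b" "rvec c \<bullet> y < rvec c \<bullet> x"
  obtains u h where "u \<in> carrier_vec n" "h \<in> carrier_vec q" "h \<in> insert (0\<^sub>v q) (graver_star AR AI)"
    "rmat AR *\<^sub>v u + rmat AI *\<^sub>v rvec h = 0\<^sub>v m" "0\<^sub>v (n + q) \<le> x + (u @\<^sub>v rvec h)"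
    "rvec c \<bullet> (u @\<^sub>v rvec h) < 0"
proof -
  have rAR: "rmat AR \<in> carrier_mat m n" using AR by simp
  have xm: "x \<in> mixed_vecs n q" and ym: "y \<in> mixed_vecs n q" using x y by (auto simp: mip_feasible_def)
  obtain xR xI where xs: "xR \<in> carrier_vec n" "xI \<in> carrier_vec q" "x = xR @\<^sub>v rvec xI"
    using mixed_vecs_split[OF xm] .
  obtain yR yI where ys: "yR \<in> carrier_vec n" "yI \<in> carrier_vec q" "y = yR @\<^sub>v rvec yI"
    using mixed_vecs_split[OF ym] .
  define u where "u = yR - xR"
  define z where "z = yI - xI"
  have uc: "u \<in> carrier_vec n" and zc: "z \<in> carrier_vec q" using xs ys by (simp_all add: u_def z_def)
  have yx: "y = x + (u @\<^sub>v rvec z)"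
    unfolding xs(3) ys(3) using xs(1,2) ys(1,2) by (auto intro!: eq_vecI simp: u_def z_def)
  have xc: "x \<in> carrier_vec (n + q)" using xm by (simp add: mixed_vecs_def)
  have uzc: "u @\<^sub>v rvec z \<in> carrier_vec (n + q)" using uc zc by (intro append_carrier_vec) auto
  let ?A = "rmat (append_cols AR AI)"
  have A: "?A \<in> carrier_mat m (n + q)" using append_cols_carrier[OF AR AI] by simp
  have "?A *\<^sub>v x + ?A *\<^sub>v (u @\<^sub>v rvec z) = ?A *\<^sub>v x"
    using x y mult_add_distrib_mat_vec[OF A xc uzc] by (simp add: mip_feasible_def yx)
  then have "?A *\<^sub>v (u @\<^sub>v rvec z) = 0\<^sub>v m"
    using A by (auto simp: vec_eq_iff simp del: index_mult_mat_vec)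
  then have Auz: "rmat AR *\<^sub>v u + rmat AI *\<^sub>v rvec z = 0\<^sub>v m"
    using append_cols_mult_vec[OF AR AI uc, of "rvec z"] zc by simp
  have eq_neg: "rmat AR *\<^sub>v w = - (rmat AI *\<^sub>v rvec h) \<longleftrightarrow> rmat AR *\<^sub>v w + rmat AI *\<^sub>v rvec h = 0\<^sub>v m" for w h
    using AR AI by (auto simp: vec_eq_iff eq_neg_iff_add_eq_0 simp del: index_mult_mat_vec)
  obtain a F where F: "finite F" "F \<subseteq> graver_star AR AI" "F \<subseteq> carrier_vec q"
    "\<And>h. h \<in> F \<Longrightarrow> 1 \<le> a h" "z = finsum_vec TYPE(int) q (\<lambda>h. int (a h) \<cdot>\<^sub>v h) F"
    and orth: "\<And>j. j < q \<Longrightarrow> (\<forall>h\<in>F. 0 \<le> h $ j) \<or> (\<forall>h\<in>F. h $ j \<le> 0)"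
    and sign: "\<And>J p. J \<in> bases AR \<Longrightarrow> p < m \<Longrightarrow>
      (\<forall>h\<in>F. 0 \<le> row (basis_tableau AR AI J) p \<bullet> rvec h) \<or>
      (\<forall>h\<in>F. row (basis_tableau AR AI J) p \<bullet> rvec h \<le> 0)"
    using graver_decomposition[OF AR AI zc] by blast
  obtain U r where U: "\<And>h. h \<in> F \<Longrightarrow> U h \<in> carrier_vec n" "\<And>h. h \<in> F \<Longrightarrow> conformal (U h) u"
      "\<And>h. h \<in> F \<Longrightarrow> rmat AR *\<^sub>v U h = - (rmat AI *\<^sub>v rvec h)"
    and r: "r \<in> carrier_vec n" "conformal r u" "rmat AR *\<^sub>v r = 0\<^sub>v m"
    and sum: "\<And>i. i < n \<Longrightarrow> u $ i = (\<Sum>h\<in>F. real (a h) * U h $ i) + r $ i"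
    using real_part_splits_along_summands[OF AR AI rank F(1,3,4,5) sign uc] Auz eq_neg by blast
  have hc: "h \<in> carrier_vec q" if "h \<in> F" for h using F(3) that by auto
  define t where "t h = U h @\<^sub>v rvec h" for h
  define r' where "r' = r @\<^sub>v rvec (0\<^sub>v q)"
  have tc: "t h \<in> carrier_vec (n + q)" if "h \<in> F" for h
    unfolding t_def using U(1)[OF that] hc[OF that] by (intro append_carrier_vec) auto
  have r'c: "r' \<in> carrier_vec (n + q)"
    unfolding r'_def using r(1) by (intro append_carrier_vec) auto
  have decomp: "(u @\<^sub>v rvec z) $ i = (\<Sum>h\<in>F. real (a h) * t h $ i) + r' $ i \<and>
      ((\<forall>h\<in>F. 0 \<le> t h $ i) \<and> 0 \<le> r' $ i \<or> (\<forall>h\<in>F. t h $ i \<le> 0) \<and> r' $ i \<le> 0)"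
    if i: "i < n + q" for i
  proof (cases "i < n")
    case True
    have t: "t h $ i = U h $ i" if "h \<in> F" for h
      using True U(1)[OF that] hc[OF that] by (simp add: t_def)
    have r': "r' $ i = r $ i" using True r(1) by (simp add: r'_def)
    have "0 \<le> u $ i \<or> u $ i \<le> 0" by linarith
    then show ?thesis
      using sum[OF True] True uc zc conformalD[OF U(2) uc True] conformalD[OF r(2) uc True]
      by (auto simp: t r')
  next
    case False
    then obtain j where j: "i = n + j" "j < q" using i by (metis add_diff_inverse_nat nat_add_left_cancel_less)
    have t: "t h $ i = of_int (h $ j)" if "h \<in> F" for h
      using j U(1)[OF that] hc[OF that] by (simp add: t_def)
    have r': "r' $ i = 0" using j r(1) by (simp add: r'_def)
    have "(u @\<^sub>v rvec z) $ i = of_int (z $ j)" using j uc zc by simp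
    also have "z $ j = (\<Sum>h\<in>F. int (a h) * h $ j)"
      unfolding F(5) by (rule int_comb_index[OF F(1,3) j(2)])
    finally show ?thesis
      using orth[OF j(2)] by (simp add: t r')
  qed
  have nonneg: "(\<forall>h\<in>F. 0 \<le> x $ i + t h $ i) \<and> 0 \<le> x $ i + r' $ i" if i: "i < n + q" for i
  proof (rule sign_consistent_summands[where a = a, OF F(1)])
    show "1 \<le> a h" if "h \<in> F" for h using F(4) that .
    show "(\<forall>h\<in>F. 0 \<le> t h $ i) \<and> 0 \<le> r' $ i \<or> (\<forall>h\<in>F. t h $ i \<le> 0) \<and> r' $ i \<le> 0"
      using decomp[OF i] by blast
    show "0 \<le> x $ i" using x nonneg_vec_index[OF _ i] by (simp add: mip_feasible_def)
    have "0 \<le> y $ i" using y(1) nonneg_vec_index[OF _ i] by (simp add: mip_feasible_def)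
    moreover have "y $ i = x $ i + (u @\<^sub>v rvec z) $ i" unfolding yx using uc zc i by simp
    moreover note conjunct1[OF decomp[OF i]]
    ultimately show "0 \<le> x $ i + ((\<Sum>h\<in>F. real (a h) * t h $ i) + r' $ i)"
      by linarith
  qed
  have cc: "rvec c \<in> carrier_vec (n + q)" using c by simp
  have "rvec c \<bullet> (u @\<^sub>v rvec z) < 0"
    using y(2) scalar_prod_add_distrib[OF cc xc uzc] unfolding yx by linarith
  moreover have "rvec c \<bullet> (u @\<^sub>v rvec z) = (\<Sum>h\<in>F. real (a h) * (rvec c \<bullet> t h)) + rvec c \<bullet> r'"
  proof -
    have "rvec c \<bullet> (u @\<^sub>v rvec z) = (\<Sum>i\<in>{0..<n + q}. rvec c $ i * (u @\<^sub>v rvec z) $ i)"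
      unfolding scalar_prod_def carrier_vecD[OF uzc] ..
    also have "\<dots> = (\<Sum>i\<in>{0..<n + q}. (\<Sum>h\<in>F. real (a h) * (rvec c $ i * t h $ i)) + rvec c $ i * r' $ i)"
    proof (rule sum.cong)
      fix i assume "i \<in> {0..<n + q}"
      then have i: "i < n + q" by simp
      show "rvec c $ i * (u @\<^sub>v rvec z) $ i =
          (\<Sum>h\<in>F. real (a h) * (rvec c $ i * t h $ i)) + rvec c $ i * r' $ i"
        unfolding conjunct1[OF decomp[OF i]] distrib_left sum_distrib_left
        by (simp only: mult.left_commute)
    qed simp
    also have "\<dots> = (\<Sum>h\<in>F. \<Sum>i\<in>{0..<n + q}. real (a h) * (rvec c $ i * t h $ i)) +
        (\<Sum>i\<in>{0..<n + q}. rvec c $ i * r' $ i)"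
      unfolding sum.distrib by (rule arg_cong2[OF sum.swap refl])
    also have "(\<Sum>i\<in>{0..<n + q}. rvec c $ i * r' $ i) = rvec c \<bullet> r'"
      unfolding scalar_prod_def carrier_vecD[OF r'c] ..
    also have "(\<Sum>h\<in>F. \<Sum>i\<in>{0..<n + q}. real (a h) * (rvec c $ i * t h $ i)) =
        (\<Sum>h\<in>F. real (a h) * (rvec c \<bullet> t h))"
    proof (rule sum.cong)
      fix h assume "h \<in> F"
      then show "(\<Sum>i\<in>{0..<n + q}. real (a h) * (rvec c $ i * t h $ i)) = real (a h) * (rvec c \<bullet> t h)"
        unfolding scalar_prod_def carrier_vecD[OF tc[OF \<open>h \<in> F\<close>]] sum_distrib_left by simp
    qed simp
    finally show ?thesis .
  qed
  ultimately have "(\<exists>h\<in>F. rvec c \<bullet> t h < 0) \<or> rvec c \<bullet> r' < 0"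
  proof -
    assume neg: "rvec c \<bullet> (u @\<^sub>v rvec z) < 0"
      and eq: "rvec c \<bullet> (u @\<^sub>v rvec z) = (\<Sum>h\<in>F. real (a h) * (rvec c \<bullet> t h)) + rvec c \<bullet> r'"
    show ?thesis
    proof (rule ccontr)
      assume "\<not> ?thesis"
      then have "0 \<le> (\<Sum>h\<in>F. real (a h) * (rvec c \<bullet> t h))" "0 \<le> rvec c \<bullet> r'"
        by (auto intro!: sum_nonneg simp: not_less)
      then show False using neg eq by simp
    qed
  qed
  then show ?thesis
  proof
    assume "\<exists>h\<in>F. rvec c \<bullet> t h < 0"
    then obtain h where h: "h \<in> F" "rvec c \<bullet> t h < 0" by blast
    show ?thesis
    proof (rule that[OF U(1)[OF h(1)] hc[OF h(1)]])
      show "h \<in> insert (0\<^sub>v q) (graver_star AR AI)" using F(2) h(1) by blast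
      show "rmat AR *\<^sub>v U h + rmat AI *\<^sub>v rvec h = 0\<^sub>v m" using U(3)[OF h(1)] eq_neg by blast
      show "0\<^sub>v (n + q) \<le> x + (U h @\<^sub>v rvec h)"
        using nonneg h(1) xc tc[OF h(1)] by (auto simp: less_eq_vec_def t_def[symmetric])
      show "rvec c \<bullet> (U h @\<^sub>v rvec h) < 0" using h(2) by (simp add: t_def)
    qed
  next
    assume neg: "rvec c \<bullet> r' < 0"
    show ?thesis
    proof (rule that[OF r(1), of "0\<^sub>v q"])
      show "rmat AR *\<^sub>v r + rmat AI *\<^sub>v rvec (0\<^sub>v q) = 0\<^sub>v m"
        unfolding r(3) rvec_zero using AI by (auto intro!: eq_vecI)
      show "0\<^sub>v (n + q) \<le> x + (r @\<^sub>v rvec (0\<^sub>v q))"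
        using nonneg xc r'c by (auto simp: less_eq_vec_def r'_def[symmetric])
      show "rvec c \<bullet> (r @\<^sub>v rvec (0\<^sub>v q)) < 0" using neg by (simp add: r'_def)
    qed auto
  qed
qed

theorem theorem3:
  fixes AR AI :: "int mat" and m nR nI :: nat
  assumes "AR \<in> carrier_mat m nR" and "AI \<in> carrier_mat m nI"
    and "vec_space.rank m (rmat AR) = m"
    and "nR > m"
  shows "finite (T_star AR AI) \<and> finite (circuits AR) \<and>
    universal_double_test_set nR nI (append_cols AR AI) (T_star AR AI) (padded_circuits AR nI)"
proof (intro conjI)
  note AR = assms(1) and AI = assms(2) and rank = assms(3)
  show "finite (T_star AR AI)"
    unfolding T_star_def basic_directions_def
    using finite_bases finite_graver_star[OF AR AI] by simp
  show "finite (circuits AR)" by (rule finite_circuits)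
  let ?A = "append_cols AR AI"
  have A: "rmat ?A \<in> carrier_mat m (nR + nI)" using append_cols_carrier[OF AR AI] by simp
  show "universal_double_test_set nR nI ?A (T_star AR AI) (padded_circuits AR nI)"
    unfolding universal_double_test_set_def
  proof (intro ballI impI)
    fix b c x
    assume c: "c \<in> carrier_vec (nR + nI)" and x: "x \<in> mip_feasible nR nI ?A b"
      and "\<not> mip_optimal nR nI ?A b c x"
    then obtain y where y: "y \<in> mip_feasible nR nI ?A b" "rvec c \<bullet> y < rvec c \<bullet> x"
      by (auto simp: mip_optimal_def not_le)
    obtain u h where uh: "u \<in> carrier_vec nR" "h \<in> carrier_vec nI"
      "h \<in> insert (0\<^sub>v nI) (graver_star AR AI)"
      "rmat AR *\<^sub>v u + rmat AI *\<^sub>v rvec h = 0\<^sub>v m" "0\<^sub>v (nR + nI) \<le> x + (u @\<^sub>v rvec h)"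
      "rvec c \<bullet> (u @\<^sub>v rvec h) < 0"
      using improving_kernel_step_exists[OF AR AI rank c x y] .
    let ?t = "u @\<^sub>v rvec h"
    let ?f = "\<lambda>\<beta> s l. finsum_vec TYPE(real) (nR + nI) (\<lambda>i. \<beta> i \<cdot>\<^sub>v s i) {..<l}"
    obtain t\<^sub>0 and l :: nat and s \<beta> where t\<^sub>0: "t\<^sub>0 \<in> T_star AR AI \<union> {0\<^sub>v (nR + nI)}"
      and s: "\<forall>i<l. s i \<in> padded_circuits AR nI \<and> 0 \<le> \<beta> i"
      and tc0: "t\<^sub>0 \<in> carrier_vec (nR + nI)" "?f \<beta> s l \<in> carrier_vec (nR + nI)" and sum: "t\<^sub>0 + ?f \<beta> s l = ?t"
      using kernel_step_eq_test_direction_plus_circuits[OF AR AI rank uh(1,3,2,4)] by blast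
    have xm: "x \<in> mixed_vecs nR nI" using x by (simp add: mip_feasible_def)
    then have xc: "x \<in> carrier_vec (nR + nI)" by (simp add: mixed_vecs_def)
    have tm: "?t \<in> mixed_vecs nR nI" using mixed_vecs_append[OF uh(1,2)] .
    then have tc: "?t \<in> carrier_vec (nR + nI)" by (simp add: mixed_vecs_def)
    have "rmat ?A *\<^sub>v (x + ?t) = rvec b + 0\<^sub>v m"
      using mult_add_distrib_mat_vec[OF A xc tc] append_cols_mult_vec[OF AR AI uh(1)] uh(2,4) x
      by (simp add: mip_feasible_def)
    moreover have "rvec b \<in> carrier_vec m"
    proof -
      have "rvec b = rmat ?A *\<^sub>v x" using x by (simp add: mip_feasible_def)
      then show ?thesis using A xc by (metis mult_mat_vec_carrier)
    qed
    ultimately have feas: "x + ?t \<in> mip_feasible nR nI ?A b"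
      using mixed_vecs_add[OF xm tm] uh(5) by (simp add: mip_feasible_def)
    have less: "rvec c \<bullet> (x + ?t) < rvec c \<bullet> x"
      using scalar_prod_add_distrib[of "rvec c" "nR + nI" x ?t] c xc tc uh(6) by simp
    have eq: "x + t\<^sub>0 + ?f \<beta> s l = x + ?t"
      using assoc_add_vec[OF xc tc0] sum by simp
    show "\<exists>t\<^sub>0\<in>T_star AR AI \<union> {0\<^sub>v (nR + nI)}. \<exists>(l::nat) s \<beta>.
        (\<forall>i<l. s i \<in> padded_circuits AR nI \<and> 0 \<le> \<beta> i) \<and>
        (let x' = x + t\<^sub>0 + ?f \<beta> s l in x' \<in> mip_feasible nR nI ?A b \<and> rvec c \<bullet> x' < rvec c \<bullet> x)"
      unfolding Let_def
      by (intro bexI[OF _ t\<^sub>0] exI[of _ l] exI[of _ s] exI[of _ \<beta>] conjI s)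
        (simp_all only: eq feas less)
  qed
qed

end
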